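(* Let $A$ be an $N\times N$ symmetric positive definite matrix, $b\in\mathbb R^N$, let $u\in\mathbb R^N$ be the solution of $Au=b$, and let $u^{(1)},\dots,u^{(q)}$ be the successive approximations produced by the exact gamblet transform described in the context. Then $u^{(q)}=u$. Moreover, assume that there exist constants $C_{\mathfrak d}\ge 1$ and $H\in(0,1)$ such that (i) $\displaystyle \frac{1}{C_{\mathfrak d}\sqrt{\lambda_{\min}(A)}}H^k\le \inf_{0\neq x\in \operatorname{Im}(\pi^{(q,k)})}\frac{\sqrt{x^TA^{-1}x}}{|x|}$ for $k\in\{1,\dots,q\}$, and (ii) $\displaystyle \sup_{0\ne x\in\operatorname{Ker}(\pi^{(k,q)})}\frac{\sqrt{x^TA^{-1}x}}{|x|}\le \frac{C_{\mathfrak d}}{\sqrt{\lambda_{\min}(A)}}H^k$ for $k\in\{1,\dots,q-1\}$. Then there exists a constant $C$ depending only on $C_{\mathfrak d}$ such that, for $k\in\{1,\dots,q-1\}$, $$|u-u^{(k)}|_A\le \frac{C}{\sqrt{\lambda_{\min}(A)}}H^k|b|.$$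
   Context: $|\cdot|$ is the Euclidean norm, $|x|_A:=\sqrt{x^TAx}$, $\lambda_{\min}$ the smallest eigenvalue. Index tree: $\mathcal I^{(q)}$ is a finite set of $q$-tuples $i=(i_1,\dots,i_q)$ with $N$ elements, used to relabel $\{1,\dots,N\}$ (so $\mathbb R^N=\mathbb R^{\mathcal I^{(q)}}$ with canonical basis $(e_i)_{i\in\mathcal I^{(q)}}$). For a tuple $i$ of length $\geq k$, $i^{(k)}:=(i_1,\dots,i_k)$, and $\mathcal I^{(k)}:=\{i^{(k)}: i\in\mathcal I^{(q)}\}$. $I^{(k)}$ is the $\mathcal I^{(k)}\times\mathcal I^{(k)}$ identity matrix. For $k\in\{1,\dots,q-1\}$, $\pi^{(k,k+1)}$ is an $\mathcal I^{(k)}\times\mathcal I^{(k+1)}$ matrix with $\pi^{(k,k+1)}(\pi^{(k,k+1)})^T=I^{(k)}$; $\pi^{(k,q)}:=\pi^{(k,k+1)}\pi^{(k+1,k+2)}\cdots\pi^{(q-1,q)}$, $\pi^{(q,q)}:=I^{(q)}$, and $\pi^{(q,k)}:=(\pi^{(k,q)})^T$. For $k\in\{2,\dots,q\}$, $\mathcal J^{(k)}$ is a finite set of $k$-tuples with $\{j^{(k-1)}:j\in\mathcal J^{(k)}\}=\mathcal I^{(k-1)}$ and, for each $i\in\mathcal I^{(k-1)}$, $\#\{j\in\mathcal J^{(k)}:j^{(k-1)}=i\}=\#\{s\in\mathcal I^{(k)}:s^{(k-1)}=i\}-1$. $J^{(k)}$ is the $\mathcal J^{(k)}\times\mathcal J^{(k)}$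 identity. $W^{(k)}$ is a $\mathcal J^{(k)}\times\mathcal I^{(k)}$ matrix with $\operatorname{Im}(W^{(k),T})=\operatorname{Ker}(\pi^{(k-1,k)})$ and $W^{(k)}W^{(k),T}=J^{(k)}$. Exact gamblet transform/solve: set $A^{(q)}=A$, $\psi^{(q)}_i=e_i$, $b^{(q)}=b$. For $k=q,q-1,\dots,2$: $B^{(k)}=W^{(k)}A^{(k)}W^{(k),T}$; $w^{(k)}=(B^{(k)})^{-1}W^{(k)}b^{(k)}$; $\chi^{(k)}_i=\sum_{j\in\mathcal I^{(k)}}W^{(k)}_{i,j}\psi^{(k)}_j$ for $i\in\mathcal J^{(k)}$; $v^{(k)}=\sum_{i\in\mathcal J^{(k)}}w^{(k)}_i\chi^{(k)}_i$; $N^{(k)}=A^{(k)}W^{(k),T}(B^{(k)})^{-1}$; $R^{(k-1,k)}=\pi^{(k-1,k)}(I^{(k)}-N^{(k)}W^{(k)})$; $b^{(k-1)}=R^{(k-1,k)}b^{(k)}$; $A^{(k-1)}=R^{(k-1,k)}A^{(k)}(R^{(k-1,k)})^T$; $\psi^{(k-1)}_i=\sum_{j\in\mathcal I^{(k)}}R^{(k-1,k)}_{i,j}\psi^{(k)}_j$ for $i\in\mathcal I^{(k-1)}$. Finally $w^{(1)}=(A^{(1)})^{-1}b^{(1)}$ and $v^{(1)}=\sum_{i\in\mathcal I^{(1)}}w^{(1)}_i\psi^{(1)}_i$. $u^{(k)}:=v^{(1)}+v^{(2)}+\dots+v^{(k)}$ for $k\in\{1,\dots,q\}$. *)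

theory Defs
  imports "HOL-Analysis.Analysis"
begin

section \<open>Vectors and matrices with arbitrary finite index sets\<close>

text \<open>
  The space of real vectors indexed by a finite set \<open>K\<close>, and of real \<open>K \<times> L\<close> matrices, are
  represented by the functions vanishing outside the index set. Thus equality of vectors or
  matrices is equality of functions. Products carry the index set of summation explicitly.
  The Euclidean norm of \<open>x\<close> is \<open>L2_set x K\<close>.
\<close>

definition rvec :: "'i set \<Rightarrow> ('i \<Rightarrow> real) set" where
  "rvec K = {x. \<forall>i. i \<notin> K \<longrightarrow> x i = 0}"

definition rmat :: "'i set \<Rightarrow> 'j set \<Rightarrow> ('i \<Rightarrow> 'j \<Rightarrow> real) set" where
  "rmat K L = {X. \<forall>i j. i \<notin> K \<or> j \<notin> L \<longrightarrow> X i j = 0}"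

definition mat_mul :: "('i \<Rightarrow> 'j \<Rightarrow> real) \<Rightarrow> 'j set \<Rightarrow> ('j \<Rightarrow> 'l \<Rightarrow> real) \<Rightarrow> 'i \<Rightarrow> 'l \<Rightarrow> real"
    ("(_ \<cdot>\<^bsub>_\<^esub> _)" [70, 0, 71] 70) where
  "X \<cdot>\<^bsub>K\<^esub> Y = (\<lambda>i l. \<Sum>k\<in>K. X i k * Y k l)"

definition mat_vec :: "('i \<Rightarrow> 'j \<Rightarrow> real) \<Rightarrow> 'j set \<Rightarrow> ('j \<Rightarrow> real) \<Rightarrow> 'i \<Rightarrow> real"
    ("(_ \<odot>\<^bsub>_\<^esub> _)" [70, 0, 71] 70) where
  "X \<odot>\<^bsub>K\<^esub> x = (\<lambda>i. \<Sum>k\<in>K. X i k * x k)"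

definition transp_mat :: "('i \<Rightarrow> 'j \<Rightarrow> real) \<Rightarrow> 'j \<Rightarrow> 'i \<Rightarrow> real" where
  "transp_mat X = (\<lambda>j i. X i j)"

definition id_mat :: "'i set \<Rightarrow> 'i \<Rightarrow> 'i \<Rightarrow> real" where
  "id_mat K = (\<lambda>i j. if i \<in> K \<and> i = j then 1 else 0)"

definition inv_mat :: "'i set \<Rightarrow> ('i \<Rightarrow> 'i \<Rightarrow> real) \<Rightarrow> 'i \<Rightarrow> 'i \<Rightarrow> real" where
  "inv_mat K X = (THE Y. Y \<in> rmat K K \<and> X \<cdot>\<^bsub>K\<^esub> Y = id_mat K \<and> Y \<cdot>\<^bsub>K\<^esub> X = id_mat K)"

text \<open>In both of the following \<open>L\<close> is the column index set of \<open>X\<close>.\<close>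

definition im_mat :: "'j set \<Rightarrow> ('i \<Rightarrow> 'j \<Rightarrow> real) \<Rightarrow> ('i \<Rightarrow> real) set" where
  "im_mat L X = (\<lambda>x. X \<odot>\<^bsub>L\<^esub> x) ` rvec L"

definition ker_mat :: "'j set \<Rightarrow> ('i \<Rightarrow> 'j \<Rightarrow> real) \<Rightarrow> ('j \<Rightarrow> real) set" where
  "ker_mat L X = {x \<in> rvec L. X \<odot>\<^bsub>L\<^esub> x = (\<lambda>_. 0)}"

definition qform :: "'i set \<Rightarrow> ('i \<Rightarrow> 'i \<Rightarrow> real) \<Rightarrow> ('i \<Rightarrow> real) \<Rightarrow> real" where
  "qform K X x = (\<Sum>i\<in>K. x i * (X \<odot>\<^bsub>K\<^esub> x) i)"

definition energy_norm :: "'i set \<Rightarrow> ('i \<Rightarrow> 'i \<Rightarrow> real) \<Rightarrow> ('i \<Rightarrow> real) \<Rightarrow> real" where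
  "energy_norm K X x = sqrt (qform K X x)"

definition sym_pos_def :: "'i set \<Rightarrow> ('i \<Rightarrow> 'i \<Rightarrow> real) \<Rightarrow> bool" where
  "sym_pos_def K X \<longleftrightarrow> X \<in> rmat K K \<and> transp_mat X = X \<and>
     (\<forall>x\<in>rvec K. x \<noteq> (\<lambda>_. 0) \<longrightarrow> 0 < qform K X x)"

definition eigval :: "'i set \<Rightarrow> ('i \<Rightarrow> 'i \<Rightarrow> real) \<Rightarrow> real \<Rightarrow> bool" where
  "eigval K X l \<longleftrightarrow> (\<exists>x\<in>rvec K. x \<noteq> (\<lambda>_. 0) \<and> X \<odot>\<^bsub>K\<^esub> x = (\<lambda>i. l * x i))"

definition lambda_min :: "'i set \<Rightarrow> ('i \<Rightarrow> 'i \<Rightarrow> real) \<Rightarrow> real" where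
  "lambda_min K X = Min {l. eigval K X l}"


section \<open>Index trees and the gamblet hierarchy\<close>

text \<open>
  A tuple is a list and \<open>i\<^sup>(\<^sup>k\<^sup>)\<close> is \<open>take k i\<close>. Fields: \<open>depth G\<close> is \<open>q\<close>; \<open>leaves G\<close> is the set of
  \<open>q\<close>-tuples at the finest level; \<open>jdx G k\<close> is the set \<open>J\<close> at level \<open>k\<close> (used for \<open>2 \<le> k \<le> q\<close>);
  \<open>coarse G k\<close> is the matrix \<open>\<pi>\<close> from level \<open>k + 1\<close> to level \<open>k\<close> (used for \<open>1 \<le> k < q\<close>);
  \<open>wav G k\<close> is \<open>W\<close> at level \<open>k\<close> (used for \<open>2 \<le> k \<le> q\<close>).
\<close>

type_synonym tuple = "nat list"

record gamblet_data =
  depth :: nat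
  leaves :: "tuple set"
  jdx :: "nat \<Rightarrow> tuple set"
  coarse :: "nat \<Rightarrow> tuple \<Rightarrow> tuple \<Rightarrow> real"
  wav :: "nat \<Rightarrow> tuple \<Rightarrow> tuple \<Rightarrow> real"

definition idx :: "gamblet_data \<Rightarrow> nat \<Rightarrow> tuple set" where
  "idx G k = take k ` leaves G"

definition index_tree :: "gamblet_data \<Rightarrow> bool" where
  "index_tree G \<longleftrightarrow> 1 \<le> depth G \<and> finite (leaves G) \<and> leaves G \<noteq> {} \<and>
     (\<forall>i\<in>leaves G. length i = depth G)"

definition coarse_ok :: "gamblet_data \<Rightarrow> bool" where
  "coarse_ok G \<longleftrightarrow> (\<forall>k\<in>{1..<depth G}.
     coarse G k \<in> rmat (idx G k) (idx G (k + 1)) \<and>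
     coarse G k \<cdot>\<^bsub>idx G (k + 1)\<^esub> transp_mat (coarse G k) = id_mat (idx G k))"

text \<open>The truncated subtraction of cardinalities is harmless, as every node has a child.\<close>

definition jdx_ok :: "gamblet_data \<Rightarrow> bool" where
  "jdx_ok G \<longleftrightarrow> (\<forall>k\<in>{2..depth G}.
     finite (jdx G k) \<and> (\<forall>j\<in>jdx G k. length j = k) \<and>
     take (k - 1) ` jdx G k = idx G (k - 1) \<and>
     (\<forall>i\<in>idx G (k - 1).
        card {j \<in> jdx G k. take (k - 1) j = i} = card {s \<in> idx G k. take (k - 1) s = i} - 1))"

definition wav_ok :: "gamblet_data \<Rightarrow> bool" where
  "wav_ok G \<longleftrightarrow> (\<forall>k\<in>{2..depth G}.
     wav G k \<in> rmat (jdx G k) (idx G k) \<and>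
     im_mat (jdx G k) (transp_mat (wav G k)) = ker_mat (idx G k) (coarse G (k - 1)) \<and>
     wav G k \<cdot>\<^bsub>idx G k\<^esub> transp_mat (wav G k) = id_mat (jdx G k))"

definition gamblet_hierarchy :: "gamblet_data \<Rightarrow> bool" where
  "gamblet_hierarchy G \<longleftrightarrow> index_tree G \<and> coarse_ok G \<and> jdx_ok G \<and> wav_ok G"

text \<open>\<open>coarse_to_fine G k\<close> is the product of the \<open>\<pi>\<close> from level \<open>k\<close> to level \<open>q\<close>, that is the
  \<open>idx G k \<times> leaves G\<close> matrix \<open>\<pi>\<^sup>(\<^sup>k\<^sup>,\<^sup>q\<^sup>)\<close>.\<close>

function coarse_to_fine :: "gamblet_data \<Rightarrow> nat \<Rightarrow> tuple \<Rightarrow> tuple \<Rightarrow> real" where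
  "coarse_to_fine G k =
     (if k < depth G then coarse G k \<cdot>\<^bsub>idx G (k + 1)\<^esub> coarse_to_fine G (k + 1)
      else id_mat (leaves G))"
  by pat_completeness auto
termination by (relation "Wellfounded.measure (\<lambda>(G, k). depth G - k)") auto

declare coarse_to_fine.simps [simp del]


section \<open>The exact gamblet transform\<close>

text \<open>The step functions take the level-\<open>k\<close> matrix \<open>M = A\<^sup>(\<^sup>k\<^sup>)\<close> as an argument; they give
  \<open>B\<^sup>(\<^sup>k\<^sup>)\<close>, \<open>N\<^sup>(\<^sup>k\<^sup>)\<close> and \<open>R\<^sup>(\<^sup>k\<^sup>-\<^sup>1\<^sup>,\<^sup>k\<^sup>)\<close>.\<close>

definition B_step :: "gamblet_data \<Rightarrow> nat \<Rightarrow> (tuple \<Rightarrow> tuple \<Rightarrow> real) \<Rightarrow> tuple \<Rightarrow> tuple \<Rightarrow> real" where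
  "B_step G k M = wav G k \<cdot>\<^bsub>idx G k\<^esub> M \<cdot>\<^bsub>idx G k\<^esub> transp_mat (wav G k)"

definition N_step :: "gamblet_data \<Rightarrow> nat \<Rightarrow> (tuple \<Rightarrow> tuple \<Rightarrow> real) \<Rightarrow> tuple \<Rightarrow> tuple \<Rightarrow> real" where
  "N_step G k M =
     M \<cdot>\<^bsub>idx G k\<^esub> transp_mat (wav G k) \<cdot>\<^bsub>jdx G k\<^esub> inv_mat (jdx G k) (B_step G k M)"

definition R_step :: "gamblet_data \<Rightarrow> nat \<Rightarrow> (tuple \<Rightarrow> tuple \<Rightarrow> real) \<Rightarrow> tuple \<Rightarrow> tuple \<Rightarrow> real" where
  "R_step G k M = coarse G (k - 1) \<cdot>\<^bsub>idx G k\<^esub>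
     (\<lambda>i j. id_mat (idx G k) i j - (N_step G k M \<cdot>\<^bsub>jdx G k\<^esub> wav G k) i j)"

function A_lvl :: "gamblet_data \<Rightarrow> (tuple \<Rightarrow> tuple \<Rightarrow> real) \<Rightarrow> nat \<Rightarrow> tuple \<Rightarrow> tuple \<Rightarrow> real" where
  "A_lvl G A k =
     (if k < depth G then
        (let M = A_lvl G A (k + 1); R = R_step G (k + 1) M
         in R \<cdot>\<^bsub>idx G (k + 1)\<^esub> M \<cdot>\<^bsub>idx G (k + 1)\<^esub> transp_mat R)
      else A)"
  by pat_completeness auto
termination by (relation "Wellfounded.measure (\<lambda>(G, A, k). depth G - k)") auto

declare A_lvl.simps [simp del]

definition B_lvl :: "gamblet_data \<Rightarrow> (tuple \<Rightarrow> tuple \<Rightarrow> real) \<Rightarrow> nat \<Rightarrow> tuple \<Rightarrow> tuple \<Rightarrow> real" where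
  "B_lvl G A k = B_step G k (A_lvl G A k)"

text \<open>\<open>R_lvl G A k\<close> is \<open>R\<^sup>(\<^sup>k\<^sup>-\<^sup>1\<^sup>,\<^sup>k\<^sup>)\<close>.\<close>

definition R_lvl :: "gamblet_data \<Rightarrow> (tuple \<Rightarrow> tuple \<Rightarrow> real) \<Rightarrow> nat \<Rightarrow> tuple \<Rightarrow> tuple \<Rightarrow> real" where
  "R_lvl G A k = R_step G k (A_lvl G A k)"

function b_lvl ::
  "gamblet_data \<Rightarrow> (tuple \<Rightarrow> tuple \<Rightarrow> real) \<Rightarrow> (tuple \<Rightarrow> real) \<Rightarrow> nat \<Rightarrow> tuple \<Rightarrow> real" where
  "b_lvl G A b k =
     (if k < depth G then R_lvl G A (k + 1) \<odot>\<^bsub>idx G (k + 1)\<^esub> b_lvl G A b (k + 1) else b)"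
  by pat_completeness auto
termination by (relation "Wellfounded.measure (\<lambda>(G, A, b, k). depth G - k)") auto

declare b_lvl.simps [simp del]

text \<open>\<open>psi G A k i\<close> is the vector \<open>\<psi>\<^sub>i\<^sup>(\<^sup>k\<^sup>)\<close>; a linear combination of the family with coefficient
  matrix \<open>X\<close> is therefore the matrix product of \<open>X\<close> with \<open>psi G A k\<close>. The rows of \<open>id_mat\<close> are
  the canonical basis vectors.\<close>

function psi :: "gamblet_data \<Rightarrow> (tuple \<Rightarrow> tuple \<Rightarrow> real) \<Rightarrow> nat \<Rightarrow> tuple \<Rightarrow> (tuple \<Rightarrow> real)" where
  "psi G A k =
     (if k < depth G then R_lvl G A (k + 1) \<cdot>\<^bsub>idx G (k + 1)\<^esub> psi G A (k + 1)
      else id_mat (leaves G))"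
  by pat_completeness auto
termination by (relation "Wellfounded.measure (\<lambda>(G, A, k). depth G - k)") auto

declare psi.simps [simp del]

definition chi :: "gamblet_data \<Rightarrow> (tuple \<Rightarrow> tuple \<Rightarrow> real) \<Rightarrow> nat \<Rightarrow> tuple \<Rightarrow> (tuple \<Rightarrow> real)" where
  "chi G A k = wav G k \<cdot>\<^bsub>idx G k\<^esub> psi G A k"

definition w_lvl ::
  "gamblet_data \<Rightarrow> (tuple \<Rightarrow> tuple \<Rightarrow> real) \<Rightarrow> (tuple \<Rightarrow> real) \<Rightarrow> nat \<Rightarrow> tuple \<Rightarrow> real" where
  "w_lvl G A b k =
     (if k = 1 then inv_mat (idx G 1) (A_lvl G A 1) \<odot>\<^bsub>idx G 1\<^esub> b_lvl G A b 1
      else inv_mat (jdx G k) (B_lvl G A k) \<odot>\<^bsub>jdx G k\<^esub> (wav G k \<odot>\<^bsub>idx G k\<^esub> b_lvl G A b k))"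

definition v_lvl ::
  "gamblet_data \<Rightarrow> (tuple \<Rightarrow> tuple \<Rightarrow> real) \<Rightarrow> (tuple \<Rightarrow> real) \<Rightarrow> nat \<Rightarrow> tuple \<Rightarrow> real" where
  "v_lvl G A b k =
     (if k = 1 then (\<lambda>l. \<Sum>i\<in>idx G 1. w_lvl G A b 1 i * psi G A 1 i l)
      else (\<lambda>l. \<Sum>i\<in>jdx G k. w_lvl G A b k i * chi G A k i l))"

definition u_lvl ::
  "gamblet_data \<Rightarrow> (tuple \<Rightarrow> tuple \<Rightarrow> real) \<Rightarrow> (tuple \<Rightarrow> real) \<Rightarrow> nat \<Rightarrow> tuple \<Rightarrow> real" where
  "u_lvl G A b k = (\<lambda>l. \<Sum>m=1..k. v_lvl G A b m l)"

end

theory Submission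
  imports Defs
begin

text \<open>
  Write \<open>P\<close> for \<open>coarse_to_fine G k\<close> and \<open>\<Psi>\<close> for the matrix \<open>psi G A k\<close>. By downward induction
  \<open>A\<^sup>(\<^sup>k\<^sup>) = \<Psi> A \<Psi>\<^sup>T\<close>, \<open>b\<^sup>(\<^sup>k\<^sup>) = \<Psi> b\<close>, \<open>P \<Psi>\<^sup>T = I\<close>, and the rows of \<open>\<Psi>\<close> are \<open>A\<close>-orthogonal to the
  kernel of \<open>P\<close>. One step of the transform splits the solution of the level-\<open>k\<close> system, so that
  \<open>u\<^sup>(\<^sup>k\<^sup>)\<close> is the Galerkin solution in the span of the rows of \<open>\<Psi>\<close>; hence the error \<open>e = u - u\<^sup>(\<^sup>k\<^sup>)\<close>
  lies in the kernel of \<open>P\<close> and \<open>|e|\<^sub>A\<^sup>2 = e\<^sup>T b\<close>. If \<open>\<surd>(x\<^sup>T A\<^sup>-\<^sup>1 x) \<le> d |x|\<close>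
  on this kernel, duality gives \<open>|e| \<le> d |e|\<^sub>A\<close>, and therefore \<open>|e|\<^sub>A \<le> d |b|\<close>. So \<open>C = C\<^sub>d\<close>
  works. The spectral theory of \<open>A\<close> enters only through \<open>\<lambda>\<^sub>m\<^sub>i\<^sub>n > 0\<close>, which gives \<open>d \<ge> 0\<close>:
  for a trivial kernel the supremum in (ii) is a junk value and says nothing about the sign.
\<close>

section \<open>Matrices over finite index sets\<close>

abbreviation dot :: "'i set \<Rightarrow> ('i \<Rightarrow> real) \<Rightarrow> ('i \<Rightarrow> real) \<Rightarrow> real" where
  "dot K x y \<equiv> \<Sum>i\<in>K. x i * y i"

lemma rvecD: "x \<in> rvec K \<Longrightarrow> i \<notin> K \<Longrightarrow> x i = 0"
  by (simp add: rvec_def)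

lemma rvec_eqI: "x \<in> rvec K \<Longrightarrow> y \<in> rvec K \<Longrightarrow> (\<And>i. i \<in> K \<Longrightarrow> x i = y i) \<Longrightarrow> x = y"
  by (metis ext rvecD)

lemma rvec_zero [simp]: "(\<lambda>_. 0) \<in> rvec K"
  by (simp add: rvec_def)

lemma rvec_diff: "x \<in> rvec K \<Longrightarrow> y \<in> rvec K \<Longrightarrow> (\<lambda>i. x i - y i) \<in> rvec K"
  by (simp add: rvec_def)

lemma rvec_add_scale: "x \<in> rvec K \<Longrightarrow> y \<in> rvec K \<Longrightarrow> (\<lambda>i. x i + t * y i) \<in> rvec K"
  by (simp add: rvec_def)

lemma rmat_transp: "X \<in> rmat K L \<Longrightarrow> transp_mat X \<in> rmat L K"
  by (auto simp: rmat_def transp_mat_def)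

lemma rmat_mul: "X \<in> rmat K L \<Longrightarrow> Y \<in> rmat L' M \<Longrightarrow> X \<cdot>\<^bsub>P\<^esub> Y \<in> rmat K M"
  by (auto simp: rmat_def mat_mul_def)

lemma rmat_id: "id_mat K \<in> rmat K K"
  by (auto simp: rmat_def id_mat_def)

lemma rmat_diff: "X \<in> rmat K L \<Longrightarrow> Y \<in> rmat K L \<Longrightarrow> (\<lambda>i j. X i j - Y i j) \<in> rmat K L"
  by (auto simp: rmat_def)

lemma mat_vec_rvec: "X \<in> rmat K L \<Longrightarrow> X \<odot>\<^bsub>P\<^esub> x \<in> rvec K"
  by (auto simp: rmat_def rvec_def mat_vec_def)

lemma mat_mul_assoc:
  assumes "finite K" "finite L"
  shows "(X \<cdot>\<^bsub>K\<^esub> Y) \<cdot>\<^bsub>L\<^esub> Z = X \<cdot>\<^bsub>K\<^esub> (Y \<cdot>\<^bsub>L\<^esub> Z)"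
  unfolding mat_mul_def sum_distrib_left sum_distrib_right
  by (intro ext, subst sum.swap) (simp add: mult.assoc)

lemma mat_vec_mul:
  assumes "finite K" "finite L"
  shows "(X \<cdot>\<^bsub>K\<^esub> Y) \<odot>\<^bsub>L\<^esub> z = X \<odot>\<^bsub>K\<^esub> (Y \<odot>\<^bsub>L\<^esub> z)"
  unfolding mat_mul_def mat_vec_def sum_distrib_left sum_distrib_right
  by (intro ext, subst sum.swap) (simp add: mult.assoc)

lemma transp_transp [simp]: "transp_mat (transp_mat X) = X"
  by (simp add: transp_mat_def)

lemma transp_mul: "transp_mat (X \<cdot>\<^bsub>K\<^esub> Y) = transp_mat Y \<cdot>\<^bsub>K\<^esub> transp_mat X"
  by (simp add: transp_mat_def mat_mul_def mult.commute)

lemma transp_id [simp]: "transp_mat (id_mat K) = id_mat K"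
  by (auto simp: transp_mat_def id_mat_def fun_eq_iff)

lemma mul_id_left:
  assumes "finite K" "X \<in> rmat K L"
  shows "id_mat K \<cdot>\<^bsub>K\<^esub> X = X"
proof (intro ext)
  fix i j
  have "(id_mat K \<cdot>\<^bsub>K\<^esub> X) i j = (\<Sum>k\<in>K. if i = k then X k j else 0)"
    by (auto simp: mat_mul_def id_mat_def intro!: sum.cong)
  also have "\<dots> = X i j" using assms by (auto simp: rmat_def)
  finally show "(id_mat K \<cdot>\<^bsub>K\<^esub> X) i j = X i j" .
qed

lemma mul_id_right:
  assumes "finite L" "X \<in> rmat K L"
  shows "X \<cdot>\<^bsub>L\<^esub> id_mat L = X"
  using mul_id_left[OF assms(1) rmat_transp[OF assms(2)]]
  by (metis transp_id transp_mul transp_transp)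

lemma mat_vec_id:
  assumes "finite K" "x \<in> rvec K"
  shows "id_mat K \<odot>\<^bsub>K\<^esub> x = x"
proof (intro ext)
  fix i
  have "(id_mat K \<odot>\<^bsub>K\<^esub> x) i = (\<Sum>k\<in>K. if i = k then x k else 0)"
    by (auto simp: mat_vec_def id_mat_def intro!: sum.cong)
  also have "\<dots> = x i" using assms by (auto simp: rvec_def)
  finally show "(id_mat K \<odot>\<^bsub>K\<^esub> x) i = x i" .
qed

lemma mat_vec_zero [simp]: "X \<odot>\<^bsub>K\<^esub> (\<lambda>_. 0) = (\<lambda>_. 0)"
  by (simp add: mat_vec_def)

lemma zero_mat_vec [simp]: "(\<lambda>_ _. 0) \<odot>\<^bsub>K\<^esub> x = (\<lambda>_. 0)"
  by (simp add: mat_vec_def)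

lemma mat_vec_diff: "X \<odot>\<^bsub>K\<^esub> (\<lambda>i. x i - y i) = (\<lambda>i. (X \<odot>\<^bsub>K\<^esub> x) i - (X \<odot>\<^bsub>K\<^esub> y) i)"
  by (simp add: mat_vec_def sum_subtractf right_diff_distrib)

lemma mat_vec_add: "X \<odot>\<^bsub>K\<^esub> (\<lambda>i. x i + y i) = (\<lambda>i. (X \<odot>\<^bsub>K\<^esub> x) i + (X \<odot>\<^bsub>K\<^esub> y) i)"
  by (simp add: mat_vec_def sum.distrib distrib_left)

lemma mat_vec_scale: "X \<odot>\<^bsub>K\<^esub> (\<lambda>i. t * x i) = (\<lambda>i. t * (X \<odot>\<^bsub>K\<^esub> x) i)"
  by (simp add: mat_vec_def sum_distrib_left mult.left_commute)

lemma mul_diff_left: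
  "(\<lambda>i j. Y i j - Z i j) \<cdot>\<^bsub>K\<^esub> X = (\<lambda>i j. (Y \<cdot>\<^bsub>K\<^esub> X) i j - (Z \<cdot>\<^bsub>K\<^esub> X) i j)"
  by (simp add: mat_mul_def sum_subtractf left_diff_distrib)

lemma mul_zero_right [simp]: "X \<cdot>\<^bsub>K\<^esub> (\<lambda>_ _. 0) = (\<lambda>_ _. 0)"
  by (simp add: mat_mul_def)

lemma dot_adjoint: "dot K x (X \<odot>\<^bsub>L\<^esub> y) = dot L (transp_mat X \<odot>\<^bsub>K\<^esub> x) y"
  unfolding mat_vec_def transp_mat_def sum_distrib_left sum_distrib_right
  by (subst sum.swap) (simp add: ac_simps)

lemma dot_self_eq_0:
  assumes "finite K" "x \<in> rvec K" "dot K x x = 0"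
  shows "x = (\<lambda>_. 0)"
proof -
  have "\<forall>i\<in>K. x i * x i = 0"
    using assms(1,3) by (subst (asm) sum_nonneg_eq_0_iff) auto
  then show ?thesis using assms(2) by (intro rvec_eqI) auto
qed

lemma L2_set_dot: "(L2_set x K)\<^sup>2 = dot K x x"
  unfolding L2_set_def power2_eq_square[symmetric]
  by (intro real_sqrt_pow2 sum_nonneg) simp

lemma im_mat_memI: "x \<in> rvec L \<Longrightarrow> X \<odot>\<^bsub>L\<^esub> x \<in> im_mat L X"
  by (auto simp: im_mat_def)

section \<open>Quadratic forms and the Cauchy-Schwarz inequality\<close>

lemma qform_expand:
  assumes "transp_mat X = X"
  shows "qform K X (\<lambda>i. x i + t * y i)
    = qform K X x + 2 * t * dot K y (X \<odot>\<^bsub>K\<^esub> x) + t\<^sup>2 * qform K X y"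
proof -
  have sym: "dot K x (X \<odot>\<^bsub>K\<^esub> y) = dot K y (X \<odot>\<^bsub>K\<^esub> x)"
    by (subst dot_adjoint) (simp add: assms mult.commute)
  have "qform K X (\<lambda>i. x i + t * y i)
    = qform K X x + t * dot K x (X \<odot>\<^bsub>K\<^esub> y) + t * dot K y (X \<odot>\<^bsub>K\<^esub> x) + t\<^sup>2 * qform K X y"
    by (simp add: qform_def mat_vec_add mat_vec_scale algebra_simps sum.distrib
        sum_distrib_left power2_eq_square)
  then show ?thesis using sym by simp
qed

text \<open>Along the line \<open>x + t y\<close> the form is a nonnegative polynomial of degree at
  most two in \<open>t\<close>, which bounds its middle coefficient. Only semidefiniteness is
  assumed, because \<open>eigval_exists\<close> applies this to a singular matrix.\<close>

lemma qform_Cauchy_Schwarz: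
  assumes "transp_mat X = X" "\<And>x. x \<in> rvec K \<Longrightarrow> 0 \<le> qform K X x"
    and x: "x \<in> rvec K" and y: "y \<in> rvec K"
  shows "(dot K y (X \<odot>\<^bsub>K\<^esub> x))\<^sup>2 \<le> qform K X x * qform K X y"
proof -
  define a b c where "a = qform K X x" and "b = dot K y (X \<odot>\<^bsub>K\<^esub> x)" and "c = qform K X y"
  have *: "0 \<le> a + 2 * t * b + t\<^sup>2 * c" for t
    unfolding a_def b_def c_def qform_expand[OF assms(1), symmetric]
    using rvec_add_scale[OF x y] assms(2) by blast
  have c: "0 \<le> c" using assms(2) y by (simp add: c_def)
  have "b\<^sup>2 \<le> a * c"
  proof (cases "c = 0")
    case True
    have "b = 0"
    proof (rule ccontr)
      \<comment> \<open>With \<open>c = 0\<close> the polynomial is affine in \<open>t\<close>; this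
        \<open>t\<close> gives it the value -1.\<close>
      assume "b \<noteq> 0"
      then have "2 * (- (a + 1) / (2 * b)) * b = - (a + 1)" by simp
      then show False using *[of "- (a + 1) / (2 * b)"] True by simp
    qed
    then show ?thesis using True by simp
  next
    case False
    \<comment> \<open>\<open>t = - b / c\<close> is the minimiser of the parabola.\<close>
    then have "a + 2 * (- b / c) * b + (- b / c)\<^sup>2 * c = (a * c - b\<^sup>2) / c"
      by (simp add: field_simps power2_eq_square)
    then show ?thesis using *[of "- b / c"] c False by (simp add: zero_le_divide_iff)
  qed
  then show ?thesis by (simp add: a_def b_def c_def)
qed

section \<open>Symmetric positive definite matrices: solvability, inverse, congruence\<close>

lemma spd_rmat: "sym_pos_def K X \<Longrightarrow> X \<in> rmat K K"
  and spd_sym: "sym_pos_def K X \<Longrightarrow> transp_mat X = X"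
  and spd_pos: "sym_pos_def K X \<Longrightarrow> x \<in> rvec K \<Longrightarrow> x \<noteq> (\<lambda>_. 0) \<Longrightarrow> 0 < qform K X x"
  by (auto simp: sym_pos_def_def)

lemma spd_nonneg: "sym_pos_def K X \<Longrightarrow> x \<in> rvec K \<Longrightarrow> 0 \<le> qform K X x"
  by (cases "x = (\<lambda>_. 0)") (auto dest: spd_pos simp: qform_def less_imp_le)

lemma spd_inj:
  assumes "sym_pos_def K X" "x \<in> rvec K" "X \<odot>\<^bsub>K\<^esub> x = (\<lambda>_. 0)"
  shows "x = (\<lambda>_. 0)"
  using spd_pos[OF assms(1,2)] assms(3) by (fastforce simp: qform_def)

text \<open>The induction eliminates one index at a time; the Schur complement is
  the value of the form at a vector with entry \<open>1\<close> at the eliminated index.\<close>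

lemma pos_def_solvable:
  assumes "finite K" "\<And>x. x \<in> rvec K \<Longrightarrow> x \<noteq> (\<lambda>_. 0) \<Longrightarrow> 0 < qform K X x"
  shows "\<exists>x\<in>rvec K. \<forall>i\<in>K. (X \<odot>\<^bsub>K\<^esub> x) i = b i"
  using assms
proof (induction K arbitrary: b rule: finite_induct)
  case empty
  show ?case by (auto intro: rvec_zero)
next
  case (insert a K)
  have ext: "(X \<odot>\<^bsub>insert a K\<^esub> x) i = X i a * x a + (X \<odot>\<^bsub>K\<^esub> x) i" for x i
    using insert.hyps by (simp add: mat_vec_def)
  have upd: "X \<odot>\<^bsub>K\<^esub> (x(a := t)) = X \<odot>\<^bsub>K\<^esub> x" for x t
    using insert.hyps by (auto simp: mat_vec_def intro!: ext sum.cong)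
  have pos: "0 < qform K X x" if "x \<in> rvec K" "x \<noteq> (\<lambda>_. 0)" for x
  proof -
    have "x a = 0" using that insert.hyps by (auto dest: rvecD)
    then have "qform (insert a K) X x = qform K X x"
      using insert.hyps by (simp add: qform_def ext)
    moreover have "x \<in> rvec (insert a K)" using that by (auto simp: rvec_def)
    ultimately show ?thesis using insert.prems[of x] that by simp
  qed
  obtain y where y: "y \<in> rvec K" "\<And>i. i \<in> K \<Longrightarrow> (X \<odot>\<^bsub>K\<^esub> y) i = b i"
    using insert.IH[OF pos, of b] by blast
  obtain z where z: "z \<in> rvec K" "\<And>i. i \<in> K \<Longrightarrow> (X \<odot>\<^bsub>K\<^esub> z) i = X i a"
    using insert.IH[OF pos, of "\<lambda>i. X i a"] by blast
  define S where "S = X a a - (X \<odot>\<^bsub>K\<^esub> z) a"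
  \<comment> \<open>On \<open>K\<close> the vector \<open>X d\<close> vanishes by the choice of
    \<open>z\<close>, so only row \<open>a\<close> contributes to the form at \<open>d\<close>, and
    its value is \<open>S\<close>.\<close>
  define d where "d = (\<lambda>i. 0 - z i)(a := 1)"
  have Xd: "(X \<odot>\<^bsub>insert a K\<^esub> d) i = X i a - (X \<odot>\<^bsub>K\<^esub> z) i" for i
    unfolding ext d_def upd mat_vec_diff by simp
  have "d \<in> rvec (insert a K)" using z by (auto simp: d_def rvec_def)
  moreover have "d \<noteq> (\<lambda>_. 0)" by (auto simp: d_def fun_eq_iff)
  moreover have "dot K d (X \<odot>\<^bsub>insert a K\<^esub> d) = 0"
    by (intro sum.neutral) (simp add: Xd z)
  then have "qform (insert a K) X d = S"
    using insert.hyps by (simp add: qform_def Xd S_def) (simp add: d_def)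
  ultimately have S: "0 < S" using insert.prems[of d] by simp
  \<comment> \<open>Once the unknowns in \<open>K\<close> are expressed as \<open>y - t z\<close>,
    the equation in row \<open>a\<close> becomes \<open>t * S = b a - (X y) a\<close>.\<close>
  define t where "t = (b a - (X \<odot>\<^bsub>K\<^esub> y) a) / S"
  let ?x = "(\<lambda>i. y i - t * z i)(a := t)"
  have Xx: "(X \<odot>\<^bsub>insert a K\<^esub> ?x) i = X i a * t + ((X \<odot>\<^bsub>K\<^esub> y) i - t * (X \<odot>\<^bsub>K\<^esub> z) i)" for i
    unfolding ext upd mat_vec_diff mat_vec_scale by simp
  have "t * S = b a - (X \<odot>\<^bsub>K\<^esub> y) a" using S by (simp add: t_def)
  then have "(X \<odot>\<^bsub>insert a K\<^esub> ?x) a = b a"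
    unfolding Xx S_def by (simp add: algebra_simps)
  moreover have "(X \<odot>\<^bsub>insert a K\<^esub> ?x) i = b i" if "i \<in> K" for i
    unfolding Xx using y z that by simp
  moreover have "?x \<in> rvec (insert a K)" using y z by (auto simp: rvec_def)
  ultimately show ?case by blast
qed

text \<open>\<open>inv_mat\<close> is a definite description, so existence and uniqueness must be
  settled before it can be used. Solving column by column gives a right inverse \<open>Y\<close>.
  Symmetry of \<open>X\<close> makes the transpose of \<open>Y\<close> a left inverse, and every
  left inverse \<open>Z\<close> equals \<open>Y\<close> because
  \<open>Z = Z (X Y) = (Z X) Y = Y\<close>.\<close>

lemma spd_inverse:
  assumes K: "finite K" and X: "sym_pos_def K X"
  shows inv_mat_rmat: "inv_mat K X \<in> rmat K K"
    and mul_inv_mat: "X \<cdot>\<^bsub>K\<^esub> inv_mat K X = id_mat K"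
    and inv_mat_mul: "inv_mat K X \<cdot>\<^bsub>K\<^esub> X = id_mat K"
proof -
  have "\<exists>y\<in>rvec K. \<forall>i\<in>K. (X \<odot>\<^bsub>K\<^esub> y) i = id_mat K i j" for j
    using K spd_pos[OF X] by (rule pos_def_solvable)
  then obtain s where s: "\<And>j. s j \<in> rvec K" "\<And>i j. i \<in> K \<Longrightarrow> (X \<odot>\<^bsub>K\<^esub> s j) i = id_mat K i j"
    by metis
  define Y where "Y = (\<lambda>i j. if j \<in> K then s j i else 0)"
  have Y: "Y \<in> rmat K K" using s(1) by (auto simp: rmat_def Y_def dest: rvecD)
  have XY: "X \<cdot>\<^bsub>K\<^esub> Y = id_mat K"
  proof (intro ext)
    fix i j
    show "(X \<cdot>\<^bsub>K\<^esub> Y) i j = id_mat K i j"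
    proof (cases "i \<in> K \<and> j \<in> K")
      case True
      then show ?thesis using s(2)[of i j] by (simp add: mat_mul_def Y_def mat_vec_def)
    next
      case False
      then show ?thesis using rmat_mul[OF spd_rmat[OF X] Y, of K]
        by (auto simp: rmat_def id_mat_def)
    qed
  qed
  have YtX: "transp_mat Y \<cdot>\<^bsub>K\<^esub> X = id_mat K"
    using arg_cong[OF XY, of transp_mat] by (simp add: transp_mul spd_sym[OF X])
  have left: "Z = Y" if "Z \<cdot>\<^bsub>K\<^esub> X = id_mat K" "Z \<in> rmat K K" for Z
    using mat_mul_assoc[OF K K, of Z X Y] that Y XY by (simp add: mul_id_left mul_id_right K)
  have YX: "Y \<cdot>\<^bsub>K\<^esub> X = id_mat K" using left[OF YtX rmat_transp[OF Y]] YtX by simp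
  have "\<exists>!Y. Y \<in> rmat K K \<and> X \<cdot>\<^bsub>K\<^esub> Y = id_mat K \<and> Y \<cdot>\<^bsub>K\<^esub> X = id_mat K"
    using Y XY YX left by blast
  from theI'[OF this] show "inv_mat K X \<in> rmat K K" "X \<cdot>\<^bsub>K\<^esub> inv_mat K X = id_mat K"
    "inv_mat K X \<cdot>\<^bsub>K\<^esub> X = id_mat K"
    unfolding inv_mat_def by blast+
qed

lemma mul_inv_vec:
  assumes "finite K" "sym_pos_def K X" "x \<in> rvec K"
  shows "X \<odot>\<^bsub>K\<^esub> (inv_mat K X \<odot>\<^bsub>K\<^esub> x) = x"
  using assms by (simp add: mat_vec_mul[symmetric] mul_inv_mat mat_vec_id)

lemma inv_mul_vec:
  assumes "finite K" "sym_pos_def K X" "x \<in> rvec K"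
  shows "inv_mat K X \<odot>\<^bsub>K\<^esub> (X \<odot>\<^bsub>K\<^esub> x) = x"
  using assms by (simp add: mat_vec_mul[symmetric] inv_mat_mul mat_vec_id)

text \<open>The form of the new matrix at \<open>x\<close> is the form of \<open>X\<close> at
  \<open>transp_mat Z\<close> applied to \<open>x\<close>. The matrix \<open>Y\<close> certifies
  that \<open>transp_mat Z\<close> is injective, so a nonzero \<open>x\<close> has a nonzero
  image.\<close>

lemma spd_congruence:
  assumes "finite K" "finite L" "sym_pos_def K X" "Z \<in> rmat L K" "Y \<in> rmat L K"
    and YZ: "Y \<cdot>\<^bsub>K\<^esub> transp_mat Z = id_mat L"
  shows "sym_pos_def L (Z \<cdot>\<^bsub>K\<^esub> X \<cdot>\<^bsub>K\<^esub> transp_mat Z)"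
  unfolding sym_pos_def_def
proof (intro conjI ballI impI)
  show "Z \<cdot>\<^bsub>K\<^esub> X \<cdot>\<^bsub>K\<^esub> transp_mat Z \<in> rmat L L"
    using assms by (metis rmat_mul rmat_transp spd_rmat)
  show "transp_mat (Z \<cdot>\<^bsub>K\<^esub> X \<cdot>\<^bsub>K\<^esub> transp_mat Z) = Z \<cdot>\<^bsub>K\<^esub> X \<cdot>\<^bsub>K\<^esub> transp_mat Z"
    using assms by (simp add: transp_mul spd_sym mat_mul_assoc)
next
  fix x assume x: "x \<in> rvec L" "x \<noteq> (\<lambda>_. 0)"
  have "Y \<odot>\<^bsub>K\<^esub> (transp_mat Z \<odot>\<^bsub>L\<^esub> x) = x"
    using YZ assms x by (simp add: mat_vec_mul[symmetric] mat_vec_id)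
  then have "transp_mat Z \<odot>\<^bsub>L\<^esub> x \<noteq> (\<lambda>_. 0)" using x by auto
  then have "0 < qform K X (transp_mat Z \<odot>\<^bsub>L\<^esub> x)"
    using assms by (intro spd_pos mat_vec_rvec rmat_transp)
  also have "\<dots> = qform L (Z \<cdot>\<^bsub>K\<^esub> X \<cdot>\<^bsub>K\<^esub> transp_mat Z) x"
    using assms dot_adjoint[of x Z K "X \<odot>\<^bsub>K\<^esub> (transp_mat Z \<odot>\<^bsub>L\<^esub> x)" L]
    by (simp add: qform_def mat_vec_mul)
  finally show "0 < qform L (Z \<cdot>\<^bsub>K\<^esub> X \<cdot>\<^bsub>K\<^esub> transp_mat Z) x" .
qed

section \<open>Eigenvalues of symmetric matrices: finiteness, existence, positivity\<close>

lemma unit_scaling: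
  assumes "finite K" "x \<in> rvec K" "x \<noteq> (\<lambda>_. 0)"
  obtains r where "r\<^sup>2 = dot K x x" "r \<noteq> 0"
    "dot K (\<lambda>i. inverse r * x i) (\<lambda>i. inverse r * x i) = 1"
proof
  define r where "r = L2_set x K"
  show r: "r\<^sup>2 = dot K x x" "r \<noteq> 0"
    using L2_set_dot[of x K] dot_self_eq_0[OF assms(1,2)] assms(3) by (auto simp: r_def)
  have "dot K (\<lambda>i. inverse r * x i) (\<lambda>i. inverse r * x i) = inverse r ^ 2 * dot K x x"
    by (simp add: sum_distrib_left power2_eq_square ac_simps)
  also have "\<dots> = 1" using r by (simp add: r(1)[symmetric] power_inverse)
  finally show "dot K (\<lambda>i. inverse r * x i) (\<lambda>i. inverse r * x i) = 1" .
qed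

text \<open>The \<open>Min\<close> in \<open>lambda_min\<close> is meaningful only over a finite
  set. Unit eigenvectors for distinct eigenvalues are orthonormal, and \<open>card K + 1\<close>
  orthonormal vectors cannot fit: summing all their squared entries in two orders gives a
  contradiction.\<close>

lemma finite_eigvals:
  assumes K: "finite K" and X: "transp_mat X = X"
  shows "finite {l. eigval K X l}"
proof (rule ccontr)
  assume "infinite {l. eigval K X l}"
  then obtain E where E: "finite E" "card E = Suc (card K)" "E \<subseteq> {l. eigval K X l}"
    using infinite_arbitrarily_large by blast
  have "\<exists>x\<in>rvec K. dot K x x = 1 \<and> X \<odot>\<^bsub>K\<^esub> x = (\<lambda>i. l * x i)" if "l \<in> E" for l
  proof -
    from that E obtain x where x: "x \<in> rvec K" "x \<noteq> (\<lambda>_. 0)" "X \<odot>\<^bsub>K\<^esub> x = (\<lambda>i. l * x i)"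
      by (auto simp: eigval_def)
    obtain r where r: "r \<noteq> 0" "dot K (\<lambda>i. inverse r * x i) (\<lambda>i. inverse r * x i) = 1"
      using unit_scaling[OF K x(1,2)] by metis
    let ?y = "\<lambda>i. inverse r * x i"
    note r(2)
    moreover have "?y \<in> rvec K" using x(1) by (simp add: rvec_def)
    moreover have "X \<odot>\<^bsub>K\<^esub> ?y = (\<lambda>i. l * ?y i)" unfolding mat_vec_scale x(3) by auto
    ultimately show ?thesis by (intro bexI[of _ ?y] conjI)
  qed
  then obtain x where x: "\<And>l. l \<in> E \<Longrightarrow> x l \<in> rvec K" "\<And>l. l \<in> E \<Longrightarrow> dot K (x l) (x l) = 1"
    "\<And>l. l \<in> E \<Longrightarrow> X \<odot>\<^bsub>K\<^esub> x l = (\<lambda>i. l * x l i)"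
    by metis
  have orth: "dot K (x l) (x m) = (if l = m then 1 else 0)" if "l \<in> E" "m \<in> E" for l m
  proof (cases "l = m")
    case False
    \<comment> \<open>Symmetry moves \<open>X\<close> across the product, so the two eigenvalues
      \<open>l\<close> and \<open>m\<close> give the same multiple of it.\<close>
    have "m * dot K (x l) (x m) = dot K (x l) (X \<odot>\<^bsub>K\<^esub> x m)"
      using that by (simp add: x sum_distrib_left ac_simps)
    also have "\<dots> = dot K (X \<odot>\<^bsub>K\<^esub> x l) (x m)"
      using dot_adjoint[of "x l" X K "x m" K] X by simp
    also have "\<dots> = l * dot K (x l) (x m)"
      using that by (simp add: x sum_distrib_left ac_simps)
    finally show ?thesis using False by simp
  qed (use that x in simp)
  \<comment> \<open>Bessel's inequality for the basis vector at \<open>i\<close>; summing over \<open>i\<close> gives \<open>card E \<le> card K\<close>.\<close>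
  have bessel: "(\<Sum>l\<in>E. (x l i)\<^sup>2) \<le> 1" if i: "i \<in> K" for i
  proof -
    define s where "s = (\<Sum>l\<in>E. (x l i)\<^sup>2)"
    \<comment> \<open>\<open>g\<close> is the projection of the basis vector at \<open>i\<close>
      onto the span of the eigenvectors. Its squared norm and its entry at \<open>i\<close> are both
      \<open>s\<close>, whence \<open>s^2\<close> is at most \<open>s\<close>.\<close>
    define g where "g = (\<lambda>j. \<Sum>l\<in>E. x l i * x l j)"
    have gg: "dot K g g = s"
    proof -
      have "dot K g g = (\<Sum>j\<in>K. \<Sum>l\<in>E. \<Sum>m\<in>E. x l i * x m i * (x l j * x m j))"
        by (simp add: g_def sum_product ac_simps)
      also have "\<dots> = (\<Sum>l\<in>E. \<Sum>m\<in>E. x l i * x m i * dot K (x l) (x m))"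
        by (subst sum.swap, rule sum.cong[OF refl], subst sum.swap) (simp add: sum_distrib_left)
      also have "\<dots> = (\<Sum>l\<in>E. \<Sum>m\<in>E. if l = m then (x l i)\<^sup>2 else 0)"
        by (intro sum.cong refl) (simp add: orth power2_eq_square)
      also have "\<dots> = s" using E by (simp add: s_def)
      finally show ?thesis .
    qed
    have gi: "g i = s" by (simp add: g_def s_def power2_eq_square)
    have "(g i)\<^sup>2 \<le> dot K g g"
      unfolding power2_eq_square using K i by (intro member_le_sum) auto
    then have "s\<^sup>2 \<le> s" by (simp add: gg gi)
    then have "s \<le> 1" by (auto simp: power2_eq_square mult_le_cancel_right2 not_less)
    then show ?thesis by (simp add: s_def)
  qed
  have "real (card E) = (\<Sum>l\<in>E. dot K (x l) (x l))" using x by simp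
  also have "\<dots> = (\<Sum>i\<in>K. \<Sum>l\<in>E. (x l i)\<^sup>2)"
    by (subst sum.swap) (simp add: power2_eq_square)
  also have "\<dots> \<le> (\<Sum>i\<in>K. 1)" using bessel by (intro sum_mono)
  also have "\<dots> = real (card K)" by simp
  finally show False using E by simp
qed

lemma continuous_on_qform: "continuous_on S (qform K X)"
  unfolding qform_def mat_vec_def
  by (intro continuous_intros continuous_on_subset[OF continuous_on_product_coordinates]) auto

text \<open>The index type may be infinite, so compactness is taken in the product topology: the
  sphere is a closed part of a product of intervals, with the factor \<open>{0}\<close> at each
  index outside \<open>K\<close>.\<close>

lemma compact_unit_sphere:
  assumes K: "finite (K :: 'i set)"
  shows "compact {x \<in> rvec K. dot K x x = 1}"
proof -
  define B where "B = (\<lambda>i. if i \<in> K then {-1..1::real} else {0})"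
  have "compactin (product_topology (\<lambda>_::'i. euclideanreal) UNIV) (PiE UNIV B)"
    by (subst compactin_PiE) (auto simp: B_def)
  then have "compact (PiE UNIV B)" by (simp add: euclidean_product_topology)
  moreover have "closed {x. dot K x x = 1}"
    by (intro closed_Collect_eq continuous_intros) auto
  ultimately have "compact (PiE UNIV B \<inter> {x. dot K x x = 1})"
    by (rule compact_Int_closed)
  moreover have "PiE UNIV B \<inter> {x. dot K x x = 1} = {x \<in> rvec K. dot K x x = 1}"
  proof (intro equalityI subsetI)
    fix x assume x: "x \<in> {x \<in> rvec K. dot K x x = 1}"
    have "x i \<in> {-1..1}" if "i \<in> K" for i
    proof -
      have "(x i)\<^sup>2 \<le> dot K x x"
        unfolding power2_eq_square using K that by (intro member_le_sum) auto
      then have "\<bar>x i\<bar> \<le> 1" using x by (simp add: abs_square_le_1)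
      then show ?thesis by auto
    qed
    then show "x \<in> PiE UNIV B \<inter> {x. dot K x x = 1}"
      using x by (auto simp: B_def dest: rvecD)
  qed (force simp: B_def rvec_def PiE_iff split: if_splits)
  ultimately show ?thesis by simp
qed

text \<open>A minimiser \<open>x\<close> of the form on the unit sphere, with minimum
  \<open>m\<close>, is an eigenvector. The shifted matrix \<open>Z = X - m I\<close> is positive
  semidefinite by homogeneity and its form vanishes at \<open>x\<close>; Cauchy-Schwarz then forces
  \<open>Z x = 0\<close>.\<close>

lemma eigval_exists:
  assumes K: "finite K" "K \<noteq> {}" and X: "X \<in> rmat K K" "transp_mat X = X"
  shows "\<exists>l. eigval K X l"
proof -
  from K obtain a where a: "a \<in> K" by blast
  let ?S = "{x \<in> rvec K. dot K x x = 1}"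
  have "(\<lambda>i. if i = a then 1 else 0) \<in> ?S"
    using a K by (auto simp: rvec_def if_distrib cong: if_cong)
  then have "?S \<noteq> {}" by blast
  then obtain x where x: "x \<in> ?S" and min: "\<And>y. y \<in> ?S \<Longrightarrow> qform K X x \<le> qform K X y"
    using continuous_attains_inf[OF compact_unit_sphere[OF K(1)] _ continuous_on_qform] by blast
  define m where "m = qform K X x"
  define Z where "Z = (\<lambda>i j. X i j - m * id_mat K i j)"
  have Zv: "Z \<odot>\<^bsub>K\<^esub> y = (\<lambda>i. (X \<odot>\<^bsub>K\<^esub> y) i - m * y i)" if "y \<in> rvec K" for y
  proof -
    have "Z \<odot>\<^bsub>K\<^esub> y = (\<lambda>i. (X \<odot>\<^bsub>K\<^esub> y) i - m * (id_mat K \<odot>\<^bsub>K\<^esub> y) i)"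
      unfolding Z_def mat_vec_def left_diff_distrib sum_subtractf sum_distrib_left
      by (simp add: ac_simps)
    then show ?thesis using mat_vec_id[OF K(1) that] by simp
  qed
  have Zq: "qform K Z y = qform K X y - m * dot K y y" if "y \<in> rvec K" for y
    unfolding qform_def Zv[OF that] right_diff_distrib sum_subtractf sum_distrib_left
    by (simp add: ac_simps)
  have Zsym: "transp_mat Z = Z"
    using X(2) transp_id[of K] by (simp add: Z_def transp_mat_def fun_eq_iff)
  have Zpos: "0 \<le> qform K Z y" if y: "y \<in> rvec K" for y
  proof (cases "y = (\<lambda>_. 0)")
    case False
    obtain r where r: "r\<^sup>2 = dot K y y" "r \<noteq> 0"
      "dot K (\<lambda>i. inverse r * y i) (\<lambda>i. inverse r * y i) = 1"
      using unit_scaling[OF K(1) y False] by metis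
    let ?y = "\<lambda>i. inverse r * y i"
    have "?y \<in> ?S" using y r(3) by (simp add: rvec_def)
    then have "m \<le> qform K X ?y" using min by (simp add: m_def)
    also have "\<dots> = inverse r ^ 2 * qform K X y"
      unfolding qform_def mat_vec_scale by (simp add: sum_distrib_left power2_eq_square ac_simps)
    finally have "m * r\<^sup>2 \<le> qform K X y"
      using r(2) by (simp add: field_simps)
    then show ?thesis by (simp add: Zq y r)
  qed (simp add: qform_def)
  have xK: "x \<in> rvec K" using x by simp
  have Zx: "Z \<odot>\<^bsub>K\<^esub> x \<in> rvec K"
    using rvecD[OF xK] rvecD[OF mat_vec_rvec[OF X(1)]] by (simp add: Zv[OF xK] rvec_def)
  \<comment> \<open>Testing against the vector \<open>Z x\<close> itself turns the bound into the
    vanishing of its norm.\<close>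
  have "(dot K (Z \<odot>\<^bsub>K\<^esub> x) (Z \<odot>\<^bsub>K\<^esub> x))\<^sup>2 \<le> qform K Z x * qform K Z (Z \<odot>\<^bsub>K\<^esub> x)"
    using qform_Cauchy_Schwarz[OF Zsym Zpos xK Zx] .
  also have "qform K Z x = 0" using x by (simp add: Zq m_def)
  finally have "Z \<odot>\<^bsub>K\<^esub> x = (\<lambda>_. 0)" using dot_self_eq_0[OF K(1) Zx] by simp
  then have "X \<odot>\<^bsub>K\<^esub> x = (\<lambda>i. m * x i)" using Zv[OF xK] by (simp add: fun_eq_iff)
  moreover have "x \<noteq> (\<lambda>_. 0)" using x by auto
  ultimately show ?thesis using xK unfolding eigval_def by blast
qed

lemma lambda_min_pos:
  assumes K: "finite K" "K \<noteq> {}" and X: "sym_pos_def K X"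
  shows "0 < lambda_min K X"
proof -
  have "lambda_min K X \<in> {l. eigval K X l}"
    unfolding lambda_min_def
    using finite_eigvals[OF K(1) spd_sym[OF X]] eigval_exists[OF K spd_rmat[OF X] spd_sym[OF X]]
    by (intro Min_in) auto
  then obtain x where x: "x \<in> rvec K" "x \<noteq> (\<lambda>_. 0)" "X \<odot>\<^bsub>K\<^esub> x = (\<lambda>i. lambda_min K X * x i)"
    by (auto simp: eigval_def)
  have "0 < qform K X x" using spd_pos[OF X] x by blast
  also have "\<dots> = lambda_min K X * dot K x x"
    by (simp add: qform_def x sum_distrib_left ac_simps)
  finally show ?thesis
    using sum_nonneg[of K "\<lambda>i. x i * x i"] by (simp add: zero_less_mult_iff)
qed

lemma rmat_eqI:
  assumes "finite L" "X \<in> rmat K L" "Y \<in> rmat K L"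
    and eq: "\<And>x. x \<in> rvec L \<Longrightarrow> X \<odot>\<^bsub>L\<^esub> x = Y \<odot>\<^bsub>L\<^esub> x"
  shows "X = Y"
proof (intro ext)
  fix i j
  show "X i j = Y i j"
  proof (cases "j \<in> L")
    case True
    define e where "e = (\<lambda>l. if l = j then 1 else 0 :: real)"
    have "(Z \<odot>\<^bsub>L\<^esub> e) i = Z i j" for Z :: "'b \<Rightarrow> 'a \<Rightarrow> real"
      using True assms(1) by (simp add: mat_vec_def e_def if_distrib cong: if_cong)
    moreover have "e \<in> rvec L" using True by (auto simp: e_def rvec_def)
    ultimately show ?thesis by (metis eq)
  qed (use assms in \<open>auto simp: rmat_def\<close>)
qed

section \<open>One coarsening step\<close>

text \<open>One level of the transform, detached from trees: \<open>I\<close>, \<open>J\<close> and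
  \<open>K\<close> index the coarse, wavelet and fine coefficients.\<close>

locale coarsening =
  fixes I :: "'i set" and J :: "'j set" and K :: "'k set"
    and M :: "'k \<Rightarrow> 'k \<Rightarrow> real" and p :: "'i \<Rightarrow> 'k \<Rightarrow> real" and W :: "'j \<Rightarrow> 'k \<Rightarrow> real"
  assumes fin: "finite I" "finite J" "finite K"
    and M: "sym_pos_def K M"
    and p: "p \<in> rmat I K" "p \<cdot>\<^bsub>K\<^esub> transp_mat p = id_mat I"
    and W: "W \<in> rmat J K" "W \<cdot>\<^bsub>K\<^esub> transp_mat W = id_mat J"
      "im_mat J (transp_mat W) = ker_mat K p"
begin

definition "B = W \<cdot>\<^bsub>K\<^esub> M \<cdot>\<^bsub>K\<^esub> transp_mat W"

definition "N = M \<cdot>\<^bsub>K\<^esub> transp_mat W \<cdot>\<^bsub>J\<^esub> inv_mat J B"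

definition "R = p \<cdot>\<^bsub>K\<^esub> (\<lambda>i j. id_mat K i j - (N \<cdot>\<^bsub>J\<^esub> W) i j)"

definition "M' = R \<cdot>\<^bsub>K\<^esub> M \<cdot>\<^bsub>K\<^esub> transp_mat R"

lemma B_spd: "sym_pos_def J B"
  unfolding B_def using fin M W by (intro spd_congruence)

lemma N_rmat: "N \<in> rmat K J"
  unfolding N_def
  by (rule rmat_mul[OF rmat_mul[OF spd_rmat[OF M] rmat_transp[OF W(1)]]
        inv_mat_rmat[OF fin(2) B_spd]])

lemma id_minus_NW_rmat: "(\<lambda>i j. id_mat K i j - (N \<cdot>\<^bsub>J\<^esub> W) i j) \<in> rmat K K"
  by (intro rmat_diff rmat_id rmat_mul[OF N_rmat W(1)])

lemma R_rmat: "R \<in> rmat I K"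
  unfolding R_def by (rule rmat_mul[OF p(1) id_minus_NW_rmat])

text \<open>The range of \<open>transp_mat W\<close> lies in the kernel of \<open>p\<close>; this is
  the transposed form of that inclusion.\<close>

lemma W_transp_p: "W \<cdot>\<^bsub>K\<^esub> transp_mat p = (\<lambda>_ _. 0)"
proof -
  have "p \<cdot>\<^bsub>K\<^esub> transp_mat W = (\<lambda>_ _. 0)"
  proof (rule rmat_eqI[OF fin(2)])
    show "p \<cdot>\<^bsub>K\<^esub> transp_mat W \<in> rmat I J" by (rule rmat_mul[OF p(1) rmat_transp[OF W(1)]])
    show "(\<lambda>_ _. 0) \<in> rmat I J" by (simp add: rmat_def)
    fix x :: "'j \<Rightarrow> real" assume "x \<in> rvec J"
    then have "transp_mat W \<odot>\<^bsub>J\<^esub> x \<in> ker_mat K p" using W(3) im_mat_memI by blast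
    then show "(p \<cdot>\<^bsub>K\<^esub> transp_mat W) \<odot>\<^bsub>J\<^esub> x = (\<lambda>_ _. 0) \<odot>\<^bsub>J\<^esub> x"
      by (simp add: mat_vec_mul fin ker_mat_def)
  qed
  then have "transp_mat (p \<cdot>\<^bsub>K\<^esub> transp_mat W) = transp_mat (\<lambda>_ _. 0)" by simp
  then show ?thesis by (simp add: transp_mul) (simp add: transp_mat_def)
qed

text \<open>The correction \<open>N W\<close> kills \<open>transp_mat p\<close>, so \<open>R\<close>
  inherits the relation \<open>p p^T = I\<close>.\<close>

lemma R_transp_p: "R \<cdot>\<^bsub>K\<^esub> transp_mat p = id_mat I"
  by (simp add: R_def mat_mul_assoc fin mul_diff_left W_transp_p p
      mul_id_left[OF fin(3) rmat_transp[OF p(1)]])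

text \<open>The coarse rows are \<open>M\<close>-orthogonal to the wavelets. Indeed
  \<open>N B = M W^T\<close> by the choice of \<open>N\<close>, so \<open>I - N W\<close>
  annihilates \<open>M W^T\<close>.\<close>

lemma R_M_transp_W: "R \<cdot>\<^bsub>K\<^esub> (M \<cdot>\<^bsub>K\<^esub> transp_mat W) = (\<lambda>_ _. 0)"
proof -
  have MW: "M \<cdot>\<^bsub>K\<^esub> transp_mat W \<in> rmat K J"
    by (rule rmat_mul[OF spd_rmat[OF M] rmat_transp[OF W(1)]])
  have "N \<cdot>\<^bsub>J\<^esub> (W \<cdot>\<^bsub>K\<^esub> (M \<cdot>\<^bsub>K\<^esub> transp_mat W)) = N \<cdot>\<^bsub>J\<^esub> B"
    by (simp add: B_def mat_mul_assoc fin)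
  also have "\<dots> = M \<cdot>\<^bsub>K\<^esub> transp_mat W \<cdot>\<^bsub>J\<^esub> (inv_mat J B \<cdot>\<^bsub>J\<^esub> B)"
    unfolding N_def by (rule mat_mul_assoc) (rule fin)+
  also have "\<dots> = M \<cdot>\<^bsub>K\<^esub> transp_mat W"
    by (simp add: inv_mat_mul fin B_spd mul_id_right[OF fin(2) MW])
  finally show ?thesis
    by (simp add: R_def mat_mul_assoc fin mul_diff_left mul_id_left[OF fin(3) MW])
qed

lemma M'_spd: "sym_pos_def I M'"
  unfolding M'_def
proof (rule spd_congruence[OF fin(3,1) M R_rmat p(1)])
  show "p \<cdot>\<^bsub>K\<^esub> transp_mat R = id_mat I"
    using arg_cong[OF R_transp_p, of transp_mat] by (simp add: transp_mul)
qed

lemma R_vec_eq: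
  assumes "z \<in> rvec K" "W \<odot>\<^bsub>K\<^esub> z = (\<lambda>_. 0)"
  shows "R \<odot>\<^bsub>K\<^esub> z = p \<odot>\<^bsub>K\<^esub> z"
proof -
  have "(\<lambda>i j. id_mat K i j - (N \<cdot>\<^bsub>J\<^esub> W) i j) \<odot>\<^bsub>K\<^esub> z
    = (\<lambda>i. (id_mat K \<odot>\<^bsub>K\<^esub> z) i - ((N \<cdot>\<^bsub>J\<^esub> W) \<odot>\<^bsub>K\<^esub> z) i)"
    by (simp add: mat_vec_def left_diff_distrib sum_subtractf)
  also have "\<dots> = z" using assms fin by (simp add: mat_vec_id mat_vec_mul)
  finally show ?thesis unfolding R_def using fin by (simp add: mat_vec_mul)
qed

text \<open>\<open>W\<close> and \<open>R\<close> are jointly injective. On the kernel of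
  \<open>W\<close> the matrix \<open>R\<close> agrees with \<open>p\<close>, so \<open>z\<close>
  lies in the kernel of \<open>p\<close>, that is \<open>z = W^T y\<close>; then
  \<open>y = W z = 0\<close>.\<close>

lemma eq_0_if_W_R_0:
  assumes z: "z \<in> rvec K" and Wz: "W \<odot>\<^bsub>K\<^esub> z = (\<lambda>_. 0)" and Rz: "R \<odot>\<^bsub>K\<^esub> z = (\<lambda>_. 0)"
  shows "z = (\<lambda>_. 0)"
proof -
  have "z \<in> ker_mat K p" using R_vec_eq[OF z Wz] Rz z by (simp add: ker_mat_def)
  then obtain y where y: "y \<in> rvec J" "z = transp_mat W \<odot>\<^bsub>J\<^esub> y"
    using W(3) by (auto simp: im_mat_def)
  have "W \<odot>\<^bsub>K\<^esub> z = y" using y fin W by (simp add: mat_vec_mul[symmetric] mat_vec_id)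
  then show ?thesis using Wz y by simp
qed

text \<open>In the splitting by \<open>R\<close> and \<open>W\<close> the matrix \<open>M\<close> is
  block diagonal with blocks \<open>M'\<close> and \<open>B\<close>, so the two blocks can be solved
  independently. The residual \<open>r\<close> of the combined solution satisfies
  \<open>W M r = 0\<close> and \<open>R M r = 0\<close>, hence \<open>M r = 0\<close> and
  \<open>r = 0\<close>.\<close>

lemma solution_split:
  assumes b: "b \<in> rvec K"
  shows "inv_mat K M \<odot>\<^bsub>K\<^esub> b = (\<lambda>i. (transp_mat R \<odot>\<^bsub>I\<^esub> (inv_mat I M' \<odot>\<^bsub>I\<^esub> (R \<odot>\<^bsub>K\<^esub> b))) i
    + (transp_mat W \<odot>\<^bsub>J\<^esub> (inv_mat J B \<odot>\<^bsub>J\<^esub> (W \<odot>\<^bsub>K\<^esub> b))) i)"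
    (is "?c = (\<lambda>i. ?x i + ?y i)")
proof -
  define c' w where "c' = inv_mat I M' \<odot>\<^bsub>I\<^esub> (R \<odot>\<^bsub>K\<^esub> b)"
    and "w = inv_mat J B \<odot>\<^bsub>J\<^esub> (W \<odot>\<^bsub>K\<^esub> b)"
  have c': "c' \<in> rvec I" "M' \<odot>\<^bsub>I\<^esub> c' = R \<odot>\<^bsub>K\<^esub> b"
    unfolding c'_def using fin M'_spd R_rmat
    by (auto intro: mat_vec_rvec inv_mat_rmat mul_inv_vec)
  have w: "w \<in> rvec J" "B \<odot>\<^bsub>J\<^esub> w = W \<odot>\<^bsub>K\<^esub> b"
    unfolding w_def using fin B_spd W by (auto intro: mat_vec_rvec inv_mat_rmat mul_inv_vec)
  have WMR: "W \<cdot>\<^bsub>K\<^esub> (M \<cdot>\<^bsub>K\<^esub> transp_mat R) = (\<lambda>_ _. 0)"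
    using arg_cong[OF R_M_transp_W, of transp_mat]
    by (simp add: transp_mul spd_sym[OF M] mat_mul_assoc fin) (simp add: transp_mat_def)
  define r where "r = (\<lambda>i. ?c i - (?x i + ?y i))"
  have r: "r \<in> rvec K"
    using mat_vec_rvec[OF inv_mat_rmat[OF fin(3) M]] mat_vec_rvec[OF rmat_transp[OF R_rmat]]
      mat_vec_rvec[OF rmat_transp[OF W(1)]] by (simp add: r_def rvec_def)
  have Mc: "M \<odot>\<^bsub>K\<^esub> ?c = b" by (rule mul_inv_vec[OF fin(3) M b])
  have Mr: "M \<odot>\<^bsub>K\<^esub> r = (\<lambda>i. b i - (((M \<cdot>\<^bsub>K\<^esub> transp_mat R) \<odot>\<^bsub>I\<^esub> c') i
      + ((M \<cdot>\<^bsub>K\<^esub> transp_mat W) \<odot>\<^bsub>J\<^esub> w) i))"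
    unfolding r_def mat_vec_diff mat_vec_add Mc c'_def[symmetric] w_def[symmetric]
    by (simp add: mat_vec_mul fin)
  have 1: "(W \<cdot>\<^bsub>K\<^esub> (M \<cdot>\<^bsub>K\<^esub> transp_mat W)) \<odot>\<^bsub>J\<^esub> w = W \<odot>\<^bsub>K\<^esub> b"
    using w(2) by (simp add: B_def mat_mul_assoc fin)
  have 2: "(R \<cdot>\<^bsub>K\<^esub> (M \<cdot>\<^bsub>K\<^esub> transp_mat R)) \<odot>\<^bsub>I\<^esub> c' = R \<odot>\<^bsub>K\<^esub> b"
    using c'(2) by (simp add: M'_def mat_mul_assoc fin)
  have "W \<odot>\<^bsub>K\<^esub> (M \<odot>\<^bsub>K\<^esub> r) = (\<lambda>_. 0)"
    unfolding Mr mat_vec_diff mat_vec_add mat_vec_mul[OF fin(3,1), symmetric]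
      mat_vec_mul[OF fin(3,2), symmetric] 1 WMR by simp
  moreover have "R \<odot>\<^bsub>K\<^esub> (M \<odot>\<^bsub>K\<^esub> r) = (\<lambda>_. 0)"
    unfolding Mr mat_vec_diff mat_vec_add mat_vec_mul[OF fin(3,1), symmetric]
      mat_vec_mul[OF fin(3,2), symmetric] 2 R_M_transp_W by simp
  ultimately have "M \<odot>\<^bsub>K\<^esub> r = (\<lambda>_. 0)"
    using eq_0_if_W_R_0 mat_vec_rvec[OF spd_rmat[OF M]] by blast
  then have "r = (\<lambda>_. 0)" using spd_inj[OF M r] by blast
  then show ?thesis by (simp add: r_def fun_eq_iff)
qed

end

section \<open>The gamblet transform\<close>

locale gamblet_transform =
  fixes G :: gamblet_data and A :: "tuple \<Rightarrow> tuple \<Rightarrow> real"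
  assumes G: "gamblet_hierarchy G" and A: "sym_pos_def (leaves G) A"
begin

lemma depth_pos: "1 \<le> depth G" and finite_leaves: "finite (leaves G)"
  and leaves_nonempty: "leaves G \<noteq> {}"
  using G by (auto simp: gamblet_hierarchy_def index_tree_def)

lemma finite_idx: "finite (idx G k)"
  by (simp add: idx_def finite_leaves)

lemma idx_depth: "idx G (depth G) = leaves G"
  using G by (auto simp: gamblet_hierarchy_def index_tree_def idx_def image_iff)

text \<open>The matrix \<open>M\<close> stays free here because positive definiteness of the level
  matrices is itself obtained by an induction that uses this step.\<close>

lemma coarsening_at:
  assumes "1 \<le> k" "k < depth G" "sym_pos_def (idx G (Suc k)) M"
  shows "coarsening (idx G k) (jdx G (Suc k)) (idx G (Suc k)) M (coarse G k) (wav G (Suc k))"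
proof
  have k: "k \<in> {1..<depth G}" "Suc k \<in> {2..depth G}" using assms by auto
  show "finite (jdx G (Suc k))" "wav G (Suc k) \<in> rmat (jdx G (Suc k)) (idx G (Suc k))"
    "wav G (Suc k) \<cdot>\<^bsub>idx G (Suc k)\<^esub> transp_mat (wav G (Suc k)) = id_mat (jdx G (Suc k))"
    "im_mat (jdx G (Suc k)) (transp_mat (wav G (Suc k))) = ker_mat (idx G (Suc k)) (coarse G k)"
    using G k(2) by (fastforce simp: gamblet_hierarchy_def jdx_ok_def wav_ok_def)+
  show "coarse G k \<in> rmat (idx G k) (idx G (Suc k))"
    "coarse G k \<cdot>\<^bsub>idx G (Suc k)\<^esub> transp_mat (coarse G k) = id_mat (idx G k)"
    using G k(1) by (fastforce simp: gamblet_hierarchy_def coarse_ok_def)+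
qed (use assms finite_idx in auto)

lemma step_eq:
  assumes "coarsening (idx G k) (jdx G (Suc k)) (idx G (Suc k)) M (coarse G k) (wav G (Suc k))"
  shows "R_step G (Suc k) M
      = coarsening.R (jdx G (Suc k)) (idx G (Suc k)) M (coarse G k) (wav G (Suc k))"
    and "B_step G (Suc k) M = coarsening.B (idx G (Suc k)) M (wav G (Suc k))"
  by (simp_all add: R_step_def N_step_def B_step_def coarsening.R_def[OF assms]
      coarsening.N_def[OF assms] coarsening.B_def[OF assms])

lemma A_lvl_spd:
  assumes "k \<le> depth G" "1 \<le> k"
  shows "sym_pos_def (idx G k) (A_lvl G A k)"
  using assms
proof (induction k rule: inc_induct)
  case base
  show ?case using A by (simp add: A_lvl.simps idx_depth)
next
  case (step k)
  then have c: "coarsening (idx G k) (jdx G (Suc k)) (idx G (Suc k)) (A_lvl G A (Suc k))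
      (coarse G k) (wav G (Suc k))" by (intro coarsening_at) auto
  show ?case
    using step.hyps coarsening.M'_spd[OF c]
    by (simp add: A_lvl.simps[of G A k] Let_def step_eq[OF c] coarsening.M'_def[OF c])
qed

lemma coarsening_lvl:
  assumes "1 \<le> k" "k < depth G"
  shows "coarsening (idx G k) (jdx G (Suc k)) (idx G (Suc k)) (A_lvl G A (Suc k))
      (coarse G k) (wav G (Suc k))"
  using assms by (intro coarsening_at A_lvl_spd) auto

lemma level_rec:
  assumes k: "1 \<le> k" "k < depth G"
  defines "R \<equiv> R_lvl G A (Suc k)"
  shows "A_lvl G A k = R \<cdot>\<^bsub>idx G (Suc k)\<^esub> A_lvl G A (Suc k) \<cdot>\<^bsub>idx G (Suc k)\<^esub> transp_mat R"
    and "b_lvl G A b k = R \<odot>\<^bsub>idx G (Suc k)\<^esub> b_lvl G A b (Suc k)"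
    and "psi G A k = R \<cdot>\<^bsub>idx G (Suc k)\<^esub> psi G A (Suc k)"
    and "coarse_to_fine G k = coarse G k \<cdot>\<^bsub>idx G (Suc k)\<^esub> coarse_to_fine G (Suc k)"
    and "R = coarsening.R (jdx G (Suc k)) (idx G (Suc k)) (A_lvl G A (Suc k)) (coarse G k)
      (wav G (Suc k))"
    and "B_lvl G A (Suc k) = coarsening.B (idx G (Suc k)) (A_lvl G A (Suc k)) (wav G (Suc k))"
    and "A_lvl G A k = coarsening.M' (jdx G (Suc k)) (idx G (Suc k)) (A_lvl G A (Suc k))
      (coarse G k) (wav G (Suc k))"
proof -
  note c = coarsening_lvl[OF k]
  show 1: "A_lvl G A k = R \<cdot>\<^bsub>idx G (Suc k)\<^esub> A_lvl G A (Suc k) \<cdot>\<^bsub>idx G (Suc k)\<^esub> transp_mat R"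
    using k by (simp add: A_lvl.simps[of G A k] R_def R_lvl_def Let_def)
  show "b_lvl G A b k = R \<odot>\<^bsub>idx G (Suc k)\<^esub> b_lvl G A b (Suc k)"
    using k by (simp add: b_lvl.simps[of G A b k] R_def)
  show "psi G A k = R \<cdot>\<^bsub>idx G (Suc k)\<^esub> psi G A (Suc k)"
    using k by (simp add: psi.simps[of G A k] R_def)
  show "coarse_to_fine G k = coarse G k \<cdot>\<^bsub>idx G (Suc k)\<^esub> coarse_to_fine G (Suc k)"
    using k by (simp add: coarse_to_fine.simps[of G k])
  show 2: "R = coarsening.R (jdx G (Suc k)) (idx G (Suc k)) (A_lvl G A (Suc k)) (coarse G k)
      (wav G (Suc k))"
    by (simp add: R_def R_lvl_def step_eq[OF c])
  show "B_lvl G A (Suc k) = coarsening.B (idx G (Suc k)) (A_lvl G A (Suc k)) (wav G (Suc k))"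
    by (simp add: B_lvl_def step_eq[OF c])
  show "A_lvl G A k = coarsening.M' (jdx G (Suc k)) (idx G (Suc k)) (A_lvl G A (Suc k))
      (coarse G k) (wav G (Suc k))"
    using 1 2 by (simp add: coarsening.M'_def[OF c])
qed

lemma top_level:
  shows "A_lvl G A (depth G) = A" "b_lvl G A b (depth G) = b"
    "psi G A (depth G) = id_mat (leaves G)" "coarse_to_fine G (depth G) = id_mat (leaves G)"
  by (simp_all add: A_lvl.simps b_lvl.simps psi.simps coarse_to_fine.simps)

lemma R_lvl_rmat:
  assumes "1 \<le> k" "k < depth G"
  shows "R_lvl G A (Suc k) \<in> rmat (idx G k) (idx G (Suc k))"
  using coarsening.R_rmat[OF coarsening_lvl[OF assms]] by (simp add: level_rec(5)[OF assms])

lemma psi_rmat: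
  assumes "k \<le> depth G" "1 \<le> k"
  shows "psi G A k \<in> rmat (idx G k) (leaves G)"
  using assms
proof (induction k rule: inc_induct)
  case base
  show ?case by (simp add: top_level idx_depth rmat_id)
next
  case (step k)
  then have k: "1 \<le> k" "k < depth G" by auto
  show ?case unfolding level_rec(3)[OF k]
    using step by (intro rmat_mul[OF R_lvl_rmat[OF k]]) auto
qed

lemma coarse_to_fine_rmat:
  assumes "k \<le> depth G" "1 \<le> k"
  shows "coarse_to_fine G k \<in> rmat (idx G k) (leaves G)"
  using assms
proof (induction k rule: inc_induct)
  case base
  show ?case by (simp add: top_level idx_depth rmat_id)
next
  case (step k)
  then have k: "1 \<le> k" "k < depth G" by auto
  show ?case unfolding level_rec(4)[OF k]
    using step by (intro rmat_mul[OF coarsening.p(1)[OF coarsening_lvl[OF k]]]) auto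
qed

text \<open>The product telescopes: the inner factors collapse to the identity by induction, and
  \<open>R p^T = I\<close> remains.\<close>

lemma psi_coarse:
  assumes "k \<le> depth G" "1 \<le> k"
  shows "psi G A k \<cdot>\<^bsub>leaves G\<^esub> transp_mat (coarse_to_fine G k) = id_mat (idx G k)"
  using assms
proof (induction k rule: inc_induct)
  case base
  show ?case by (simp add: top_level idx_depth mul_id_left[OF finite_leaves rmat_id])
next
  case (step k)
  then have k: "1 \<le> k" "k < depth G" by auto
  note c = coarsening_lvl[OF k]
  have "psi G A k \<cdot>\<^bsub>leaves G\<^esub> transp_mat (coarse_to_fine G k)
    = R_lvl G A (Suc k) \<cdot>\<^bsub>idx G (Suc k)\<^esub> ((psi G A (Suc k) \<cdot>\<^bsub>leaves G\<^esub>
      transp_mat (coarse_to_fine G (Suc k))) \<cdot>\<^bsub>idx G (Suc k)\<^esub> transp_mat (coarse G k))"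
    by (simp add: level_rec(3,4)[OF k] transp_mul mat_mul_assoc finite_idx finite_leaves)
  also have "\<dots> = R_lvl G A (Suc k) \<cdot>\<^bsub>idx G (Suc k)\<^esub> transp_mat (coarse G k)"
    using step by (simp add: mul_id_left[OF finite_idx rmat_transp[OF coarsening.p(1)[OF c]]])
  also have "\<dots> = id_mat (idx G k)"
    by (simp add: level_rec(5)[OF k] coarsening.R_transp_p[OF c])
  finally show ?case .
qed

lemma A_lvl_psi:
  assumes "k \<le> depth G" "1 \<le> k"
  shows "A_lvl G A k = psi G A k \<cdot>\<^bsub>leaves G\<^esub> A \<cdot>\<^bsub>leaves G\<^esub> transp_mat (psi G A k)"
  using assms
proof (induction k rule: inc_induct)
  case base
  show ?case
    using mul_id_left[OF finite_leaves spd_rmat[OF A]] mul_id_right[OF finite_leaves spd_rmat[OF A]]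
    by (simp add: top_level)
next
  case (step k)
  then have k: "1 \<le> k" "k < depth G" by auto
  show ?case
    unfolding level_rec(1,3)[OF k] using step.IH k
    by (simp add: transp_mul mat_mul_assoc finite_idx finite_leaves)
qed

lemma b_lvl_psi:
  assumes b: "b \<in> rvec (leaves G)" and "k \<le> depth G" "1 \<le> k"
  shows "b_lvl G A b k = psi G A k \<odot>\<^bsub>leaves G\<^esub> b"
  using assms(2,3)
proof (induction k rule: inc_induct)
  case base
  show ?case using b by (simp add: top_level mat_vec_id finite_leaves)
next
  case (step k)
  then have k: "1 \<le> k" "k < depth G" by auto
  show ?case
    unfolding level_rec(2,3)[OF k] using step.IH k
    by (simp add: mat_vec_mul finite_idx finite_leaves)
qed

text \<open>By \<open>psi_coarse\<close>, the transpose of \<open>psi\<close> is a right inverse of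
  \<open>coarse_to_fine\<close>, so the interpolant has the same coarse values as
  \<open>x\<close>.\<close>

lemma minus_interpolant_in_kernel:
  assumes k: "k \<le> depth G" "1 \<le> k" and x: "x \<in> rvec (leaves G)"
  shows "(\<lambda>i. x i - (transp_mat (psi G A k) \<odot>\<^bsub>idx G k\<^esub>
    (coarse_to_fine G k \<odot>\<^bsub>leaves G\<^esub> x)) i) \<in> ker_mat (leaves G) (coarse_to_fine G k)"
proof -
  let ?P = "coarse_to_fine G k" and ?Psi = "psi G A k"
  let ?Px = "?P \<odot>\<^bsub>leaves G\<^esub> x"
  have "?P \<cdot>\<^bsub>leaves G\<^esub> transp_mat ?Psi = id_mat (idx G k)"
    using arg_cong[OF psi_coarse[OF k], of transp_mat] by (simp add: transp_mul)
  then have "?P \<odot>\<^bsub>leaves G\<^esub> (transp_mat ?Psi \<odot>\<^bsub>idx G k\<^esub> ?Px) = ?Px"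
    using mat_vec_mul[OF finite_leaves finite_idx, of ?P "transp_mat ?Psi" k ?Px]
      mat_vec_id[OF finite_idx mat_vec_rvec[OF coarse_to_fine_rmat[OF k]]] by simp
  then show ?thesis
    using rvec_diff[OF x mat_vec_rvec[OF rmat_transp[OF psi_rmat[OF k]]]]
    by (simp add: ker_mat_def mat_vec_diff)
qed

text \<open>The subtraction of the \<open>psi\<close>-interpolant of \<open>x\<close> moves a vector of the kernel at level
  \<open>k\<close> into the kernel at level \<open>k + 1\<close>.\<close>

lemma psi_A_orthogonal_kernel:
  assumes "k \<le> depth G" "1 \<le> k" "x \<in> ker_mat (leaves G) (coarse_to_fine G k)"
  shows "psi G A k \<odot>\<^bsub>leaves G\<^esub> (A \<odot>\<^bsub>leaves G\<^esub> x) = (\<lambda>_. 0)"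
  using assms
proof (induction k arbitrary: x rule: inc_induct)
  case base
  then show ?case by (auto simp: top_level ker_mat_def mat_vec_id finite_leaves)
next
  case (step k)
  then have k: "1 \<le> k" "k < depth G" by auto
  note c = coarsening_lvl[OF k]
  let ?L = "leaves G" and ?K = "idx G (Suc k)" and ?J = "jdx G (Suc k)"
  let ?P = "coarse_to_fine G (Suc k)" and ?Psi = "psi G A (Suc k)" and ?W = "wav G (Suc k)"
  note fin = finite_leaves finite_idx coarsening.fin(2)[OF c]
  have x: "x \<in> rvec ?L" and px: "coarse G k \<odot>\<^bsub>?K\<^esub> (?P \<odot>\<^bsub>?L\<^esub> x) = (\<lambda>_. 0)"
    using step.prems by (auto simp: ker_mat_def level_rec(4)[OF k] mat_vec_mul fin)
  have Px: "?P \<odot>\<^bsub>?L\<^esub> x \<in> rvec ?K"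
    using k by (intro mat_vec_rvec[OF coarse_to_fine_rmat]) auto
  \<comment> \<open>The coarse values of \<open>x\<close> at level \<open>k + 1\<close> are killed
    by one further coarsening, so they are a combination of wavelets.\<close>
  then have "?P \<odot>\<^bsub>?L\<^esub> x \<in> im_mat ?J (transp_mat ?W)"
    using px coarsening.W(3)[OF c] by (simp add: ker_mat_def)
  then obtain z where z: "?P \<odot>\<^bsub>?L\<^esub> x = transp_mat ?W \<odot>\<^bsub>?J\<^esub> z" by (auto simp: im_mat_def)
  let ?s = "transp_mat ?Psi \<odot>\<^bsub>?K\<^esub> (?P \<odot>\<^bsub>?L\<^esub> x)"
  let ?y = "\<lambda>i. x i - ?s i"
  have "?y \<in> ker_mat ?L ?P" using k x by (intro minus_interpolant_in_kernel) auto
  \<comment> \<open>Since \<open>?Psi A\<close> annihilates the remainder \<open>?y\<close>,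
    \<open>?Psi A x\<close> depends on \<open>x\<close> only through its interpolant, where
    \<open>?Psi A ?Psi^T\<close> is the level matrix.\<close>
  then have "?Psi \<odot>\<^bsub>?L\<^esub> (A \<odot>\<^bsub>?L\<^esub> ?y) = (\<lambda>_. 0)" using step.IH k by simp
  then have "?Psi \<odot>\<^bsub>?L\<^esub> (A \<odot>\<^bsub>?L\<^esub> x) = ?Psi \<odot>\<^bsub>?L\<^esub> (A \<odot>\<^bsub>?L\<^esub> ?s)"
    by (simp add: mat_vec_diff fun_eq_iff)
  also have "\<dots> = A_lvl G A (Suc k) \<odot>\<^bsub>?K\<^esub> (?P \<odot>\<^bsub>?L\<^esub> x)"
    using k A_lvl_psi[of "Suc k"] by (simp add: mat_vec_mul fin)
  finally have "psi G A k \<odot>\<^bsub>?L\<^esub> (A \<odot>\<^bsub>?L\<^esub> x)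
    = (R_lvl G A (Suc k) \<cdot>\<^bsub>?K\<^esub> (A_lvl G A (Suc k) \<cdot>\<^bsub>?K\<^esub> transp_mat ?W)) \<odot>\<^bsub>?J\<^esub> z"
    by (simp add: level_rec(3)[OF k] mat_vec_mul fin z)
  then show ?case by (simp add: level_rec(5)[OF k] coarsening.R_M_transp_W[OF c])
qed

section \<open>The partial sums as Galerkin solutions in the span of the rows of
  \<open>psi\<close>\<close>

definition galerkin :: "(tuple \<Rightarrow> real) \<Rightarrow> nat \<Rightarrow> tuple \<Rightarrow> real" where
  "galerkin b k = transp_mat (psi G A k) \<odot>\<^bsub>idx G k\<^esub>
     (inv_mat (idx G k) (A_lvl G A k) \<odot>\<^bsub>idx G k\<^esub> b_lvl G A b k)"

lemma b_lvl_rvec: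
  assumes "b \<in> rvec (leaves G)" "k \<le> depth G" "1 \<le> k"
  shows "b_lvl G A b k \<in> rvec (idx G k)"
  unfolding b_lvl_psi[OF assms] by (rule mat_vec_rvec[OF psi_rmat[OF assms(2,3)]])

text \<open>This is \<open>solution_split\<close> at level \<open>k + 1\<close>, mapped to the
  leaves by the transpose of \<open>psi\<close>: the \<open>R\<close> part is the Galerkin solution
  of level \<open>k\<close>, and the wavelet part is the increment \<open>v_lvl\<close>.\<close>

lemma galerkin_Suc:
  assumes b: "b \<in> rvec (leaves G)" and k: "1 \<le> k" "k < depth G"
  shows "galerkin b (Suc k) = (\<lambda>l. galerkin b k l + v_lvl G A b (Suc k) l)"
proof -
  note c = coarsening_lvl[OF k]
  note fin = finite_leaves finite_idx coarsening.fin(2)[OF c]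
  have v: "v_lvl G A b (Suc k) = transp_mat (psi G A (Suc k)) \<odot>\<^bsub>idx G (Suc k)\<^esub>
     (transp_mat (wav G (Suc k)) \<odot>\<^bsub>jdx G (Suc k)\<^esub> w_lvl G A b (Suc k))"
  proof -
    have "v_lvl G A b (Suc k)
      = transp_mat (chi G A (Suc k)) \<odot>\<^bsub>jdx G (Suc k)\<^esub> w_lvl G A b (Suc k)"
      using k by (simp add: v_lvl_def mat_vec_def transp_mat_def mult.commute)
    then show ?thesis by (simp add: chi_def transp_mul mat_vec_mul fin)
  qed
  have "b_lvl G A b (Suc k) \<in> rvec (idx G (Suc k))" using b k by (intro b_lvl_rvec) auto
  from coarsening.solution_split[OF c this]
  have "galerkin b (Suc k) = (\<lambda>l. (transp_mat (psi G A (Suc k)) \<odot>\<^bsub>idx G (Suc k)\<^esub>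
      (transp_mat (R_lvl G A (Suc k)) \<odot>\<^bsub>idx G k\<^esub> (inv_mat (idx G k) (A_lvl G A k) \<odot>\<^bsub>idx G k\<^esub>
        b_lvl G A b k))) l + v_lvl G A b (Suc k) l)"
    using k by (simp add: galerkin_def mat_vec_add v w_lvl_def level_rec(2,5,6,7)[OF k])
  then show ?thesis
    by (simp add: galerkin_def level_rec(3)[OF k] transp_mul mat_vec_mul fin)
qed

lemma u_lvl_eq_galerkin:
  assumes b: "b \<in> rvec (leaves G)" and "1 \<le> k" "k \<le> depth G"
  shows "u_lvl G A b k = galerkin b k"
  using assms(2,3)
proof (induction k rule: nat_induct_at_least)
  case base
  show ?case
    by (simp add: u_lvl_def v_lvl_def w_lvl_def galerkin_def mat_vec_def transp_mat_def mult.commute)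
next
  case (Suc k)
  have "u_lvl G A b (Suc k) = (\<lambda>l. u_lvl G A b k l + v_lvl G A b (Suc k) l)"
    by (simp add: u_lvl_def)
  moreover have "u_lvl G A b k = galerkin b k" using Suc by simp
  ultimately show ?case using Suc galerkin_Suc[OF b, of k] by simp
qed

text \<open>At the finest level \<open>psi\<close> is the identity, so the Galerkin solution is the
  exact one.\<close>

lemma u_lvl_depth:
  assumes "u \<in> rvec (leaves G)" "A \<odot>\<^bsub>leaves G\<^esub> u = b" "b \<in> rvec (leaves G)"
  shows "u_lvl G A b (depth G) = u"
  using assms depth_pos inv_mul_vec[OF finite_leaves A assms(1)]
  by (simp add: u_lvl_eq_galerkin galerkin_def top_level idx_depth mat_vec_id finite_leaves)

text \<open>Galerkin orthogonality and the A-orthogonality of the kernel to the span of \<open>psi\<close> place the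
  error in the kernel.\<close>

lemma error_in_kernel:
  assumes k: "1 \<le> k" "k \<le> depth G" and b: "b \<in> rvec (leaves G)"
    and u: "u \<in> rvec (leaves G)" "A \<odot>\<^bsub>leaves G\<^esub> u = b"
  defines "e \<equiv> (\<lambda>i. u i - u_lvl G A b k i)"
  shows "e \<in> ker_mat (leaves G) (coarse_to_fine G k)"
    and "qform (leaves G) A e = dot (leaves G) e b"
proof -
  let ?L = "leaves G" and ?K = "idx G k" and ?P = "coarse_to_fine G k" and ?Psi = "psi G A k"
  note fin = finite_leaves finite_idx
  define c where "c = inv_mat ?K (A_lvl G A k) \<odot>\<^bsub>?K\<^esub> b_lvl G A b k"
  have c: "A_lvl G A k \<odot>\<^bsub>?K\<^esub> c = ?Psi \<odot>\<^bsub>?L\<^esub> b"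
    unfolding c_def using k b A_lvl_spd b_lvl_rvec
    by (simp add: mul_inv_vec fin b_lvl_psi[symmetric])
  have uk: "u_lvl G A b k = transp_mat ?Psi \<odot>\<^bsub>?K\<^esub> c"
    using k b by (simp add: u_lvl_eq_galerkin galerkin_def c_def)
  have ukr: "u_lvl G A b k \<in> rvec ?L"
    unfolding uk using k by (intro mat_vec_rvec[OF rmat_transp[OF psi_rmat]]) auto
  have e: "e \<in> rvec ?L" unfolding e_def by (rule rvec_diff[OF u(1) ukr])
  have Ae: "A \<odot>\<^bsub>?L\<^esub> e = (\<lambda>i. b i - (A \<odot>\<^bsub>?L\<^esub> u_lvl G A b k) i)"
    unfolding e_def mat_vec_diff u(2) ..
  have "?Psi \<odot>\<^bsub>?L\<^esub> (A \<odot>\<^bsub>?L\<^esub> u_lvl G A b k) = A_lvl G A k \<odot>\<^bsub>?K\<^esub> c"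
    using k by (simp add: A_lvl_psi uk mat_vec_mul fin)
  then have PsiAe: "?Psi \<odot>\<^bsub>?L\<^esub> (A \<odot>\<^bsub>?L\<^esub> e) = (\<lambda>_. 0)"
    unfolding Ae mat_vec_diff c by simp
  have Pe: "?P \<odot>\<^bsub>?L\<^esub> e \<in> rvec ?K" using k by (intro mat_vec_rvec[OF coarse_to_fine_rmat]) auto
  let ?s = "transp_mat ?Psi \<odot>\<^bsub>?K\<^esub> (?P \<odot>\<^bsub>?L\<^esub> e)"
  \<comment> \<open>The error is the interpolant \<open>?s\<close> plus a kernel part.
    \<open>?Psi A\<close> kills the error and the kernel part, hence also \<open>?s\<close>;
    invertibility of the level matrix then gives \<open>?P e = 0\<close>.\<close>
  have "(\<lambda>i. e i - ?s i) \<in> ker_mat ?L ?P" using k e by (intro minus_interpolant_in_kernel)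
  then have "?Psi \<odot>\<^bsub>?L\<^esub> (A \<odot>\<^bsub>?L\<^esub> (\<lambda>i. e i - ?s i)) = (\<lambda>_. 0)"
    using psi_A_orthogonal_kernel k by blast
  then have "?Psi \<odot>\<^bsub>?L\<^esub> (A \<odot>\<^bsub>?L\<^esub> ?s) = (\<lambda>_. 0)"
    by (simp add: mat_vec_diff PsiAe fun_eq_iff)
  then have "A_lvl G A k \<odot>\<^bsub>?K\<^esub> (?P \<odot>\<^bsub>?L\<^esub> e) = (\<lambda>_. 0)"
    using k by (simp add: A_lvl_psi mat_vec_mul fin)
  then have "?P \<odot>\<^bsub>?L\<^esub> e = (\<lambda>_. 0)" using spd_inj A_lvl_spd Pe k by blast
  then show "e \<in> ker_mat ?L ?P" using e by (simp add: ker_mat_def)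
  \<comment> \<open>The approximation is a combination of rows of \<open>?Psi\<close>, so it is
    \<open>A\<close>-orthogonal to the error, and only the pairing with \<open>b\<close> survives in
    the energy.\<close>
  have "dot ?L (u_lvl G A b k) (A \<odot>\<^bsub>?L\<^esub> e) = dot ?K c (?Psi \<odot>\<^bsub>?L\<^esub> (A \<odot>\<^bsub>?L\<^esub> e))"
    unfolding uk by (rule dot_adjoint[symmetric])
  also have "\<dots> = 0" by (simp add: PsiAe)
  finally have "dot ?L (A \<odot>\<^bsub>?L\<^esub> u_lvl G A b k) e = 0"
    using dot_adjoint[of "u_lvl G A b k" A ?L e ?L] by (simp add: spd_sym[OF A])
  then show "qform ?L A e = dot ?L e b"
    by (simp add: qform_def Ae right_diff_distrib sum_subtractf mult.commute)
qed

end

section \<open>Duality and the error estimate\<close>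

lemma bdd_above_qform_quotient:
  assumes K: "finite K"
  shows "bdd_above ((\<lambda>x. sqrt (qform K X x) / L2_set x K) ` S)"
proof (rule bdd_aboveI2)
  fix x
  define n where "n = L2_set x K"
  \<comment> \<open>Every entry of \<open>x\<close> is at most \<open>n\<close> in absolute value,
    so the form is at most \<open>C * n^2\<close>. Boundedness is what lets a single quotient be
    compared with the supremum.\<close>
  define C where "C = (\<Sum>i\<in>K. \<Sum>j\<in>K. \<bar>X i j\<bar>)"
  have le: "\<bar>x i\<bar> \<le> n" if "i \<in> K" for i
  proof (rule power2_le_imp_le)
    have "(x i)\<^sup>2 \<le> dot K x x"
      unfolding power2_eq_square using K that by (intro member_le_sum) auto
    then show "\<bar>x i\<bar>\<^sup>2 \<le> n\<^sup>2" by (simp add: n_def L2_set_dot)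
  qed (simp add: n_def)
  have "qform K X x = (\<Sum>i\<in>K. \<Sum>j\<in>K. x i * (X i j * x j))"
    by (simp add: qform_def mat_vec_def sum_distrib_left)
  also have "\<dots> \<le> (\<Sum>i\<in>K. \<Sum>j\<in>K. \<bar>X i j\<bar> * n\<^sup>2)"
  proof (intro sum_mono)
    fix i j assume "i \<in> K" "j \<in> K"
    then have "\<bar>x i\<bar> * \<bar>x j\<bar> \<le> n * n" using le by (intro mult_mono) (auto simp: n_def)
    then have "\<bar>X i j\<bar> * (\<bar>x i\<bar> * \<bar>x j\<bar>) \<le> \<bar>X i j\<bar> * n\<^sup>2"
      by (intro mult_left_mono) (auto simp: power2_eq_square)
    moreover have "x i * (X i j * x j) \<le> \<bar>X i j\<bar> * (\<bar>x i\<bar> * \<bar>x j\<bar>)"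
      by (rule order_trans[OF abs_ge_self]) (simp add: abs_mult)
    ultimately show "x i * (X i j * x j) \<le> \<bar>X i j\<bar> * n\<^sup>2" by linarith
  qed
  also have "\<dots> = C * n\<^sup>2" by (simp add: C_def sum_distrib_right)
  finally have "sqrt (qform K X x) \<le> sqrt (C * n\<^sup>2)" by simp
  also have "\<dots> = sqrt C * n" by (simp add: real_sqrt_mult n_def)
  finally have le': "sqrt (qform K X x) \<le> sqrt C * n" .
  show "sqrt (qform K X x) / L2_set x K \<le> sqrt C"
  proof (cases "n = 0")
    \<comment> \<open>Division by zero gives the quotient 0, and \<open>C\<close> is
      nonnegative.\<close>
    case True
    then show ?thesis by (simp add: n_def[symmetric] C_def sum_nonneg)
  next
    case False
    then have "0 < n" by (simp add: n_def less_le)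
    then show ?thesis using le'
      by (simp add: n_def[symmetric] divide_le_eq)
  qed
qed

text \<open>Cauchy-Schwarz for the form of \<open>X\<close>, applied to \<open>e\<close> and
  \<open>y = X^-1 e\<close>: the mixed term is the squared Euclidean norm of \<open>e\<close>, and
  the form at \<open>y\<close> is the inverse form at \<open>e\<close>.\<close>

lemma L2_set_le_energy_inverse:
  assumes K: "finite K" and X: "sym_pos_def K X" and e: "e \<in> rvec K"
  shows "(L2_set e K)\<^sup>2 \<le> energy_norm K X e * sqrt (qform K (inv_mat K X) e)"
proof -
  define y where "y = inv_mat K X \<odot>\<^bsub>K\<^esub> e"
  have y: "y \<in> rvec K" "X \<odot>\<^bsub>K\<^esub> y = e"
    unfolding y_def using mat_vec_rvec[OF inv_mat_rmat[OF K X]] mul_inv_vec[OF K X e] by auto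
  have "(dot K e (X \<odot>\<^bsub>K\<^esub> y))\<^sup>2 \<le> qform K X y * qform K X e"
    using spd_sym[OF X] spd_nonneg[OF X] y(1) e by (rule qform_Cauchy_Schwarz)
  moreover have "qform K X y = qform K (inv_mat K X) e"
    using y by (simp add: qform_def y_def mult.commute)
  ultimately have "(dot K e e)\<^sup>2 \<le> qform K X e * qform K (inv_mat K X) e"
    using y by (simp add: mult.commute)
  then have "dot K e e \<le> sqrt (qform K X e * qform K (inv_mat K X) e)" by (rule real_le_rsqrt)
  then show ?thesis by (simp add: L2_set_dot energy_norm_def real_sqrt_mult)
qed

lemma (in gamblet_transform) error_bound:
  assumes k: "1 \<le> k" "k \<le> depth G" and b: "b \<in> rvec (leaves G)"
    and u: "u \<in> rvec (leaves G)" "A \<odot>\<^bsub>leaves G\<^esub> u = b"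
    and d: "0 \<le> d" "(SUP x \<in> ker_mat (leaves G) (coarse_to_fine G k) - {\<lambda>_. 0}.
      sqrt (qform (leaves G) (inv_mat (leaves G) A) x) / L2_set x (leaves G)) \<le> d"
  shows "energy_norm (leaves G) A (\<lambda>i. u i - u_lvl G A b k i) \<le> d * L2_set b (leaves G)"
proof -
  define e where "e = (\<lambda>i. u i - u_lvl G A b k i)"
  let ?L = "leaves G"
  define E n m where "E = energy_norm ?L A e" and "n = L2_set e ?L" and "m = L2_set b ?L"
  have err: "e \<in> ker_mat ?L (coarse_to_fine G k)" "qform ?L A e = dot ?L e b"
    using error_in_kernel[OF k b u] by (simp_all add: e_def)
  have m: "0 \<le> m" by (simp add: m_def)
  have "E \<le> d * m"
  proof (cases "e = (\<lambda>_. 0)")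
    case True
    then show ?thesis using d m by (simp add: E_def energy_norm_def qform_def)
  next
    case False
    have e: "e \<in> rvec ?L" using err(1) by (simp add: ker_mat_def)
    have n: "0 < n" using False dot_self_eq_0[OF finite_leaves e] L2_set_dot[of e ?L]
      L2_set_nonneg[of e ?L] unfolding n_def by (metis less_le zero_power2)
    have E: "E\<^sup>2 = dot ?L e b" "0 < E"
      using spd_pos[OF A e False] err(2) by (simp_all add: E_def energy_norm_def)
    have "sqrt (qform ?L (inv_mat ?L A) e) / n \<le> d"
      unfolding n_def using False err(1)
      by (intro order_trans[OF cSUP_upper d(2)] bdd_above_qform_quotient finite_leaves) auto
    then have "sqrt (qform ?L (inv_mat ?L A) e) \<le> d * n" using n by (simp add: divide_le_eq)
    then have "n\<^sup>2 \<le> E * (d * n)"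
      using L2_set_le_energy_inverse[OF finite_leaves A e] E(2)
      unfolding n_def[symmetric] E_def[symmetric] by (meson mult_left_mono order_trans less_imp_le)
    \<comment> \<open>Dividing by \<open>n > 0\<close> gives \<open>n \<le> E * d\<close>; combined
      with \<open>E^2 = e^T b \<le> n * m\<close> it leaves one factor \<open>E > 0\<close> to
      cancel.\<close>
    then have nE: "n \<le> E * d" using n by (simp add: power2_eq_square)
    have "E\<^sup>2 \<le> (\<Sum>i\<in>?L. \<bar>e i\<bar> * \<bar>b i\<bar>)"
      unfolding E(1) by (intro sum_mono) (simp add: abs_mult[symmetric])
    also have "\<dots> \<le> n * m" unfolding n_def m_def by (rule L2_set_mult_ineq)
    also have "\<dots> \<le> E * d * m" using nE m by (intro mult_right_mono)
    finally show ?thesis using E(2) by (simp add: power2_eq_square mult.assoc)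
  qed
  then show ?thesis by (simp add: E_def m_def e_def)
qed

theorem theorem2p6:
  "(\<forall>(G :: gamblet_data) (A :: tuple \<Rightarrow> tuple \<Rightarrow> real) (b :: tuple \<Rightarrow> real) (u :: tuple \<Rightarrow> real).
      gamblet_hierarchy G \<and> sym_pos_def (leaves G) A \<and>
      b \<in> rvec (leaves G) \<and> u \<in> rvec (leaves G) \<and> A \<odot>\<^bsub>leaves G\<^esub> u = b \<longrightarrow>
      u_lvl G A b (depth G) = u) \<and>
   (\<forall>Cd :: real. 1 \<le> Cd \<longrightarrow> (\<exists>C :: real.
      \<forall>(G :: gamblet_data) (A :: tuple \<Rightarrow> tuple \<Rightarrow> real) (b :: tuple \<Rightarrow> real) (u :: tuple \<Rightarrow> real)
        (H :: real).
        gamblet_hierarchy G \<and> sym_pos_def (leaves G) A \<and>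
        b \<in> rvec (leaves G) \<and> u \<in> rvec (leaves G) \<and> A \<odot>\<^bsub>leaves G\<^esub> u = b \<and>
        0 < H \<and> H < 1 \<and>
        (\<forall>k\<in>{1..depth G}.
           1 / (Cd * sqrt (lambda_min (leaves G) A)) * H ^ k
           \<le> (INF x \<in> im_mat (idx G k) (transp_mat (coarse_to_fine G k)) - {\<lambda>_. 0}.
                 sqrt (qform (leaves G) (inv_mat (leaves G) A) x) / L2_set x (leaves G))) \<and>
        (\<forall>k\<in>{1..<depth G}.
           (SUP x \<in> ker_mat (leaves G) (coarse_to_fine G k) - {\<lambda>_. 0}.
                 sqrt (qform (leaves G) (inv_mat (leaves G) A) x) / L2_set x (leaves G))
           \<le> Cd / sqrt (lambda_min (leaves G) A) * H ^ k) \<longrightarrow>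
        (\<forall>k\<in>{1..<depth G}.
           energy_norm (leaves G) A (\<lambda>i. u i - u_lvl G A b k i)
           \<le> C / sqrt (lambda_min (leaves G) A) * H ^ k * L2_set b (leaves G))))"
proof (intro conjI allI impI, goal_cases)
  case (1 G A b u)
  then interpret gamblet_transform G A by unfold_locales auto
  from 1 show ?case by (intro u_lvl_depth) auto
next
  case (2 Cd)
  show ?case
  \<comment> \<open>\<open>Cd\<close> is chosen before the hierarchy, the matrix, \<open>b\<close>,
    \<open>u\<close> and \<open>H\<close>; the bound then follows from \<open>error_bound\<close>
    with \<open>d = Cd / sqrt (lambda_min (leaves G) A) * H ^ k\<close>.\<close>
  proof (intro exI[of _ Cd] allI impI ballI, elim conjE, goal_cases)
    case (1 G A b u H k)
    then interpret gamblet_transform G A by unfold_locales auto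
    have "0 < lambda_min (leaves G) A"
      using lambda_min_pos[OF finite_leaves leaves_nonempty A] .
    then have "0 \<le> Cd / sqrt (lambda_min (leaves G) A) * H ^ k"
      using 1 2 by simp
    then show ?case using 1 by (intro error_bound) auto
  qed
qed

end
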